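(* Let $(\Omega,\Sigma,\mu)$ be a positive, complete, $\sigma$-finite measure space, $(\Omega_\alpha)_{\alpha\in I}$ a countable measurable partition of $\Omega$, $\mathcal X=(X_\alpha)_{\alpha\in I}$ a family of non-trivial Banach ideal spaces, $X_\alpha$ over $(\Omega_\alpha,\Sigma_\alpha,\mu_\alpha)$, and $E$ a Banach ideal space over the counting measure space $(I,2^I,m)$. Let $\mathcal X^*=(X_\alpha^* )_{\alpha\in I}$ and let $E(\mathcal X)$ be the corresponding Köthe-Herz space. If $E$ is order continuous and $E^*$ is order continuous, then $$\left(E(\mathcal X),\|\cdot\|_{E(\mathcal X)}\right)^*\equiv\left(E'(\mathcal X^* ),\|\cdot\|_{E'(\mathcal X^* )}\right).$$ If additionally $X_\alpha$ is order continuous for each $\alpha\in I$, then $$\left(E(\mathcal X),\|\cdot\|_{E(\mathcal X)}\right)'\equiv\left(E'(\mathcal X'),\|\cdot\|_{E'(\mathcal X')}\right),$$ where $\mathcal X'=(X_\alpha')_{\alpha\in I}$. Here $\equiv$ means that the spaces coincide with equal norms.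
   Context: A Banach ideal space over $(\Omega,\Sigma,\mu)$ is a linear subspace $X$ of $L^0(\Omega,\Sigma,\mu)$ (classes of real measurable functions) with a complete norm such that (i) if $f\in L^0$, $g\in X$, $|f|\le|g|$ a.e., then $f\in X$ and $\|f\|_X\le\|g\|_X$; (ii) there is $f\in X$ strictly positive on the whole of $\Omega$. Its Köthe dual is $X'=\{g\in L^0:\|g\|_{X'}=\sup_{\|f\|_X\le1}\int|fg|\,d\mu<\infty\}$; $X^*$ is the topological dual. A normed lattice $F$ is order continuous if $\|f_n\|_F\to0$ for each sequence in $F$ with $f_n\ge f_{n+1}$, $\inf_nf_n=0$. Measurable partition: $\Omega_\alpha\in\Sigma$, $\Omega=\bigcup_{\alpha}\Omega_\alpha$ $\mu$-a.e., $\mu(\Omega_\alpha\cap\Omega_\beta)=0$ for $\alpha\ne\beta$; $\Sigma_\alpha=\{\Omega_\alpha\cap B:B\in\Sigma\}$, $\mu_\alpha=\mu|_{\Sigma_\alpha}$. Köthe-Herz space: $E(\mathcal X)=\{f\in L^0(\Omega,\Sigma,\mu): f\chi_{\Omega_\alpha}\in X_\alpha\ \forall\alpha,\ (\|f\chi_{\Omega_\alpha}\|_{X_\alpha})_\alpha\in E\}$, $\|f\|_{E(\mathcal X)}=\left\|(\|f\chi_{\Omega_\alpha}\|_{X_\alpha})_\alpha\right\|_E$; $E'(\mathcal X')$ is defined in the same way. It is identified with the direct sum $\left(\oplus_\alpha X_\alpha\right)_E=\{(f_\alpha)_\alpha:f_\alpha\in X_\alpha,(\|f_\alpha\|_{X_\alpha})_\alpha\in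 E\}$ (norm $\|(\|f_\alpha\|_{X_\alpha})_\alpha\|_E$). $E'(\mathcal X^* )$ denotes the direct sum $\left(\oplus_\alpha X_\alpha^*\right)_{E'}$, acting on $E(\mathcal X)$ by $\langle f,g\rangle=\sum_\alpha g_\alpha(f\chi_{\Omega_\alpha})$. *)

theory Defs
  imports "HOL-Analysis.Analysis"
begin

text \<open>
  Elements of \<open>L\<^sup>0(\<Omega>, \<Sigma>, \<mu>)\<close> are represented by real measurable functions rather than by
  their classes. Spaces of functions are therefore closed under almost-everywhere equality,
  \<open>vle\<close> is in general only a preorder, and \<open>vnorm\<close> vanishes exactly on the functions that are
  zero almost everywhere. Values of \<open>vnorm\<close> outside \<open>carrier\<close> carry no meaning.
\<close>

record 'v normed_lattice =
  carrier :: "'v set"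
  vzero :: "'v"
  vadd :: "'v \<Rightarrow> 'v \<Rightarrow> 'v"
  vscale :: "real \<Rightarrow> 'v \<Rightarrow> 'v"
  vle :: "'v \<Rightarrow> 'v \<Rightarrow> bool"
  vnorm :: "'v \<Rightarrow> real"

definition L0_lattice ::
    "'a measure \<Rightarrow> ('a \<Rightarrow> real) set \<Rightarrow> (('a \<Rightarrow> real) \<Rightarrow> real) \<Rightarrow> ('a \<Rightarrow> real) normed_lattice" where
  "L0_lattice M X N =
    \<lparr> carrier = X,
      vzero = (\<lambda>x. 0),
      vadd = (\<lambda>f g x. f x + g x),
      vscale = (\<lambda>c f x. c * f x),
      vle = (\<lambda>f g. AE x in M. f x \<le> g x),
      vnorm = N \<rparr>"

locale banach_ideal_space =
  fixes M :: "'a measure" and X :: "('a \<Rightarrow> real) normed_lattice"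
  assumes operations: "X = L0_lattice M (carrier X) (vnorm X)"
    and measurable: "carrier X \<subseteq> borel_measurable M"
    and zero_closed: "(\<lambda>x. 0) \<in> carrier X"
    and add_closed: "\<And>f g. f \<in> carrier X \<Longrightarrow> g \<in> carrier X \<Longrightarrow> (\<lambda>x. f x + g x) \<in> carrier X"
    and scale_closed: "\<And>c f. f \<in> carrier X \<Longrightarrow> (\<lambda>x. c * f x) \<in> carrier X"
    and norm_nonneg: "\<And>f. f \<in> carrier X \<Longrightarrow> 0 \<le> vnorm X f"
    and norm_eq_0: "\<And>f. f \<in> carrier X \<Longrightarrow> vnorm X f = 0 \<longleftrightarrow> (AE x in M. f x = 0)"
    and norm_scale: "\<And>c f. f \<in> carrier X \<Longrightarrow> vnorm X (\<lambda>x. c * f x) = \<bar>c\<bar> * vnorm X f"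
    and norm_triangle: "\<And>f g. f \<in> carrier X \<Longrightarrow> g \<in> carrier X \<Longrightarrow>
          vnorm X (\<lambda>x. f x + g x) \<le> vnorm X f + vnorm X g"
    and norm_complete: "\<And>s :: nat \<Rightarrow> 'a \<Rightarrow> real. (\<And>n. s n \<in> carrier X) \<Longrightarrow>
          (\<And>e. e > 0 \<Longrightarrow> \<exists>n0. \<forall>m\<ge>n0. \<forall>n\<ge>n0. vnorm X (\<lambda>x. s m x - s n x) < e) \<Longrightarrow>
          \<exists>f\<in>carrier X. (\<lambda>n. vnorm X (\<lambda>x. s n x - f x)) \<longlonglongrightarrow> 0"
    and ideal: "\<And>f g. f \<in> borel_measurable M \<Longrightarrow> g \<in> carrier X \<Longrightarrow>
          (AE x in M. \<bar>f x\<bar> \<le> \<bar>g x\<bar>) \<Longrightarrow> f \<in> carrier X \<and> vnorm X f \<le> vnorm X g"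
    and strictly_positive: "\<exists>f\<in>carrier X. \<forall>x\<in>space M. f x > 0"

definition nontrivial_space :: "'a measure \<Rightarrow> ('a \<Rightarrow> real) normed_lattice \<Rightarrow> bool" where
  "nontrivial_space M X \<longleftrightarrow> (\<exists>f\<in>carrier X. \<not> (AE x in M. f x = 0))"

definition order_continuous :: "'v normed_lattice \<Rightarrow> bool" where
  "order_continuous F \<longleftrightarrow>
    (\<forall>s :: nat \<Rightarrow> 'v.
      (\<forall>n. s n \<in> carrier F) \<longrightarrow>
      (\<forall>n. vle F (s (Suc n)) (s n)) \<longrightarrow>
      (\<forall>n. vle F (vzero F) (s n)) \<longrightarrow>
      (\<forall>h\<in>carrier F. (\<forall>n. vle F h (s n)) \<longrightarrow> vle F h (vzero F)) \<longrightarrow>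
      (\<lambda>n. vnorm F (s n)) \<longlonglongrightarrow> 0)"

text \<open>
  Functionals are made extensional, so that two of them are equal as soon as they agree on
  the space. A bounded functional respects almost-everywhere equality automatically.
\<close>

definition topological_dual :: "'v normed_lattice \<Rightarrow> ('v \<Rightarrow> real) normed_lattice" where
  "topological_dual F =
    \<lparr> carrier = {\<phi> \<in> extensional (carrier F).
        (\<forall>f\<in>carrier F. \<forall>g\<in>carrier F. \<phi> (vadd F f g) = \<phi> f + \<phi> g) \<and>
        (\<forall>c. \<forall>f\<in>carrier F. \<phi> (vscale F c f) = c * \<phi> f) \<and>
        (\<exists>C. \<forall>f\<in>carrier F. \<bar>\<phi> f\<bar> \<le> C * vnorm F f)},
      vzero = (\<lambda>f\<in>carrier F. 0),
      vadd = (\<lambda>\<phi> \<psi>. \<lambda>f\<in>carrier F. \<phi> f + \<psi> f),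
      vscale = (\<lambda>c \<phi>. \<lambda>f\<in>carrier F. c * \<phi> f),
      vle = (\<lambda>\<phi> \<psi>. \<forall>f\<in>carrier F. vle F (vzero F) f \<longrightarrow> \<phi> f \<le> \<psi> f),
      vnorm = (\<lambda>\<phi>. SUP f\<in>{f \<in> carrier F. vnorm F f \<le> 1}. \<bar>\<phi> f\<bar>) \<rparr>"

definition koethe_dual_norm ::
    "'a measure \<Rightarrow> ('a \<Rightarrow> real) normed_lattice \<Rightarrow> ('a \<Rightarrow> real) \<Rightarrow> ennreal" where
  "koethe_dual_norm M X g =
    (SUP f\<in>{f \<in> carrier X. vnorm X f \<le> 1}. \<integral>\<^sup>+ x. ennreal \<bar>f x * g x\<bar> \<partial>M)"

definition koethe_dual ::
    "'a measure \<Rightarrow> ('a \<Rightarrow> real) normed_lattice \<Rightarrow> ('a \<Rightarrow> real) normed_lattice" where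
  "koethe_dual M X =
    L0_lattice M {g \<in> borel_measurable M. koethe_dual_norm M X g < \<infinity>}
      (\<lambda>g. enn2real (koethe_dual_norm M X g))"

definition measurable_partition :: "'a measure \<Rightarrow> 'i set \<Rightarrow> ('i \<Rightarrow> 'a set) \<Rightarrow> bool" where
  "measurable_partition M I A \<longleftrightarrow>
    (\<forall>\<alpha>\<in>I. A \<alpha> \<in> sets M) \<and>
    (AE x in M. x \<in> (\<Union>\<alpha>\<in>I. A \<alpha>)) \<and>
    (\<forall>\<alpha>\<in>I. \<forall>\<beta>\<in>I. \<alpha> \<noteq> \<beta> \<longrightarrow> emeasure M (A \<alpha> \<inter> A \<beta>) = 0)"

definition cut_off :: "('i \<Rightarrow> 'a set) \<Rightarrow> 'i \<Rightarrow> ('a \<Rightarrow> real) \<Rightarrow> 'a \<Rightarrow> real" where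
  "cut_off A \<alpha> f = (\<lambda>x. f x * indicator (A \<alpha>) x)"

text \<open>
  Below, \<open>E\<close> lives over \<^term>\<open>count_space I\<close>, so the values of a family at indices outside
  \<open>I\<close> influence neither membership in \<open>E\<close> nor its norm.
\<close>

definition koethe_herz ::
    "'a measure \<Rightarrow> 'i set \<Rightarrow> ('i \<Rightarrow> 'a set) \<Rightarrow> ('i \<Rightarrow> real) normed_lattice \<Rightarrow>
     ('i \<Rightarrow> ('a \<Rightarrow> real) normed_lattice) \<Rightarrow> ('a \<Rightarrow> real) normed_lattice" where
  "koethe_herz M I A E X =
    L0_lattice M
      {f \<in> borel_measurable M.
        (\<forall>\<alpha>\<in>I. cut_off A \<alpha> f \<in> carrier (X \<alpha>)) \<and>
        (\<lambda>\<alpha>. vnorm (X \<alpha>) (cut_off A \<alpha> f)) \<in> carrier E}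
      (\<lambda>f. vnorm E (\<lambda>\<alpha>. vnorm (X \<alpha>) (cut_off A \<alpha> f)))"

definition direct_sum ::
    "'i set \<Rightarrow> ('i \<Rightarrow> real) normed_lattice \<Rightarrow> ('i \<Rightarrow> 'v normed_lattice) \<Rightarrow>
     ('i \<Rightarrow> 'v) normed_lattice" where
  "direct_sum I E Y =
    \<lparr> carrier = {g \<in> (\<Pi>\<^sub>E \<alpha>\<in>I. carrier (Y \<alpha>)). (\<lambda>\<alpha>. vnorm (Y \<alpha>) (g \<alpha>)) \<in> carrier E},
      vzero = (\<lambda>\<alpha>\<in>I. vzero (Y \<alpha>)),
      vadd = (\<lambda>g h. \<lambda>\<alpha>\<in>I. vadd (Y \<alpha>) (g \<alpha>) (h \<alpha>)),
      vscale = (\<lambda>c g. \<lambda>\<alpha>\<in>I. vscale (Y \<alpha>) c (g \<alpha>)),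
      vle = (\<lambda>g h. \<forall>\<alpha>\<in>I. vle (Y \<alpha>) (g \<alpha>) (h \<alpha>)),
      vnorm = (\<lambda>g. vnorm E (\<lambda>\<alpha>. vnorm (Y \<alpha>) (g \<alpha>))) \<rparr>"

definition pairing ::
    "'i set \<Rightarrow> ('i \<Rightarrow> 'a set) \<Rightarrow> ('a \<Rightarrow> real) set \<Rightarrow>
     ('i \<Rightarrow> ('a \<Rightarrow> real) \<Rightarrow> real) \<Rightarrow> ('a \<Rightarrow> real) \<Rightarrow> real" where
  "pairing I A H g = (\<lambda>f\<in>H. \<Sum>\<^sub>\<infinity>\<alpha>\<in>I. g \<alpha> (cut_off A \<alpha> f))"

definition isometric_isomorphism ::
    "('v \<Rightarrow> 'w) \<Rightarrow> 'v normed_lattice \<Rightarrow> 'w normed_lattice \<Rightarrow> bool" where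
  "isometric_isomorphism T V W \<longleftrightarrow>
    bij_betw T (carrier V) (carrier W) \<and>
    (\<forall>f\<in>carrier V. \<forall>g\<in>carrier V. T (vadd V f g) = vadd W (T f) (T g)) \<and>
    (\<forall>c. \<forall>f\<in>carrier V. T (vscale V c f) = vscale W c (T f)) \<and>
    (\<forall>f\<in>carrier V. vnorm W (T f) = vnorm V f)"

definition coincide_with_equal_norms :: "'v normed_lattice \<Rightarrow> 'v normed_lattice \<Rightarrow> bool" where
  "coincide_with_equal_norms V W \<longleftrightarrow>
    carrier V = carrier W \<and> (\<forall>f\<in>carrier V. vnorm V f = vnorm W f)"

end

theory Submission
  imports Defs
begin

text \<open>
  Both halves rest on two inequalities between a space of functions and the sequence of its
  component norms. Throughout, \<open>\<parallel>f\<parallel>\<close> on the Koethe-Herz space is the norm in \<open>E\<close> of the sequence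
  of norms of the pieces \<open>f \<chi>\<^bsub>\<Omega>\<alpha>\<^esub>\<close>.

  Upper bounds come from applying an inequality of Hoelder type twice, once in every \<open>X\<^sub>\<alpha>\<close> and once
  in \<open>E\<close>. Lower bounds come from gluing: given a finite set \<open>F\<close> of indices, \<open>h\<^sub>\<alpha>\<close> in the unit ball of
  \<open>X\<^sub>\<alpha>\<close> for \<open>\<alpha> \<in> F\<close> and \<open>e\<close> in the unit ball of \<open>E\<close>, the function \<open>\<Sum>\<^sub>\<alpha> e\<^sub>\<alpha> h\<^sub>\<alpha> \<chi>\<^bsub>\<Omega>\<alpha>\<^esub>\<close> lies in the
  unit ball of the Koethe-Herz space (lemmas \<open>glue_mem\<close>, \<open>glue_norm_le\<close>). Testing against it and
  taking the supremum over each \<open>h\<^sub>\<alpha>\<close> separately (lemma \<open>sum_SUP_le\<close>) bounds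
  \<open>\<Sum>\<^bsub>\<alpha>\<in>F\<^esub> \<bar>e\<^sub>\<alpha>\<bar> k\<^sub>\<alpha>\<close>, where \<open>k\<^sub>\<alpha>\<close> is the dual norm of the component at \<open>\<alpha>\<close>, by the dual norm on the
  whole space; the supremum over \<open>e\<close> and \<open>F\<close> is the norm of \<open>k\<close> in \<open>E'\<close>. This is done for the
  functionals in \<open>sum_component_norms_le\<close> and for integrals in \<open>sum_koethe_norms_le\<close>.

  For the topological dual, a functional \<open>\<phi>\<close> has the components \<open>h \<mapsto> \<phi> (h \<chi>\<^bsub>\<Omega>\<alpha>\<^esub>)\<close>. They
  determine \<open>\<phi>\<close> because \<open>E\<close> is order continuous: the norm of \<open>f - \<Sum>\<^bsub>\<alpha>\<in>F\<^esub> f \<chi>\<^bsub>\<Omega>\<alpha>\<^esub>\<close> is the norm in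
  \<open>E\<close> of a tail of one fixed sequence, hence tends to \<open>0\<close> along the finite sets \<open>F\<close>
  (lemma \<open>functional_has_sum\<close>). So taking components inverts the pairing.

  For the Koethe dual, monotone convergence takes the place of this limit: it makes
  \<open>\<integral>\<bar>f g\<bar> d\<mu>\<close> the sum of its parts over the \<open>\<Omega>\<^sub>\<alpha>\<close> (lemma \<open>nn_integral_partition\<close>).
\<close>

section \<open>Suprema and sums of extended nonnegative reals\<close>

text \<open>
  The supremum over a product of index sets may be taken one factor at a time. The summand \<open>a\<close>
  carries the terms already treated through the induction.
\<close>

lemma sum_SUP_le:
  fixes J :: "'i \<Rightarrow> 'b \<Rightarrow> ennreal"
  assumes "finite F" and "\<And>\<alpha>. \<alpha> \<in> F \<Longrightarrow> B \<alpha> \<noteq> {}"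
    and "\<And>h. (\<And>\<alpha>. \<alpha> \<in> F \<Longrightarrow> h \<alpha> \<in> B \<alpha>) \<Longrightarrow> a + (\<Sum>\<alpha>\<in>F. J \<alpha> (h \<alpha>)) \<le> C"
  shows "a + (\<Sum>\<alpha>\<in>F. SUP x\<in>B \<alpha>. J \<alpha> x) \<le> C"
  using assms
proof (induction F arbitrary: a rule: finite_induct)
  case empty
  then show ?case by simp
next
  case (insert \<beta> F)
  have "J \<beta> y + (a + (\<Sum>\<alpha>\<in>F. SUP x\<in>B \<alpha>. J \<alpha> x)) \<le> C" if y: "y \<in> B \<beta>" for y
  proof -
    have "(a + J \<beta> y) + (\<Sum>\<alpha>\<in>F. SUP x\<in>B \<alpha>. J \<alpha> x) \<le> C"
    proof (rule insert.IH)
      fix h assume h: "\<And>\<alpha>. \<alpha> \<in> F \<Longrightarrow> h \<alpha> \<in> B \<alpha>"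
      have "(\<Sum>\<alpha>\<in>F. J \<alpha> ((h(\<beta> := y)) \<alpha>)) = (\<Sum>\<alpha>\<in>F. J \<alpha> (h \<alpha>))"
        using insert.hyps by (intro sum.cong) auto
      moreover have upd: "(h(\<beta> := y)) \<alpha> \<in> B \<alpha>" if "\<alpha> \<in> insert \<beta> F" for \<alpha>
        using that h y by auto
      ultimately show "a + J \<beta> y + (\<Sum>\<alpha>\<in>F. J \<alpha> (h \<alpha>)) \<le> C"
        using insert.prems(2)[of "h(\<beta> := y)", OF upd] insert.hyps by (simp add: add.assoc)
    qed (use insert.prems in auto)
    then show ?thesis by (simp add: ac_simps)
  qed
  then have "(SUP y\<in>B \<beta>. J \<beta> y + (a + (\<Sum>\<alpha>\<in>F. SUP x\<in>B \<alpha>. J \<alpha> x))) \<le> C"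
    by (rule SUP_least)
  then have "(SUP y\<in>B \<beta>. J \<beta> y) + (a + (\<Sum>\<alpha>\<in>F. SUP x\<in>B \<alpha>. J \<alpha> x)) \<le> C"
    using insert.prems(1) by (simp only: ennreal_SUP_add_left insertI1 simp_thms)
  then show ?case
    using insert.hyps by (simp add: ac_simps)
qed

lemma sum_le_nn_integral_count_space:
  fixes f :: "'i \<Rightarrow> ennreal"
  assumes "finite F" "F \<subseteq> I"
  shows "(\<Sum>\<alpha>\<in>F. f \<alpha>) \<le> (\<integral>\<^sup>+\<alpha>. f \<alpha> \<partial>count_space I)"
proof -
  have "(\<Sum>\<alpha>\<in>F. f \<alpha>) = (\<Sum>\<alpha>\<in>F. f \<alpha> * indicator F \<alpha>)"
    by (intro sum.cong) auto
  also have "\<dots> = (\<integral>\<^sup>+\<alpha>. f \<alpha> * indicator F \<alpha> \<partial>count_space I)"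
    using assms by (subst nn_integral_count_space'[where A = F]) auto
  also have "\<dots> \<le> (\<integral>\<^sup>+\<alpha>. f \<alpha> \<partial>count_space I)"
    by (intro nn_integral_mono) (auto split: split_indicator)
  finally show ?thesis .
qed

lemma nn_integral_count_space_le:
  fixes f :: "'i \<Rightarrow> ennreal"
  assumes "countable I" and le: "\<And>F. finite F \<Longrightarrow> F \<subseteq> I \<Longrightarrow> (\<Sum>\<alpha>\<in>F. f \<alpha>) \<le> C"
  shows "(\<integral>\<^sup>+\<alpha>. f \<alpha> \<partial>count_space I) \<le> C"
proof (cases "finite I")
  case True
  then show ?thesis using le by (simp add: nn_integral_count_space_finite)
next
  case False
  let ?e = "from_nat_into I"
  have bij: "bij_betw ?e UNIV I"
    using assms(1) False by (rule bij_betw_from_nat_into)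
  have "(\<integral>\<^sup>+\<alpha>. f \<alpha> \<partial>count_space I) = (\<Sum>n. f (?e n))"
    by (simp add: nn_integral_bij_count_space[OF bij, symmetric] nn_integral_count_space_nat)
  also have "\<dots> = (SUP n. \<Sum>i<n. f (?e i))"
    by (rule suminf_eq_SUP)
  also have "\<dots> \<le> C"
  proof (rule SUP_least)
    fix n
    have "inj_on ?e {..<n}"
      using bij by (auto simp: bij_betw_def intro: inj_on_subset)
    then have "(\<Sum>i<n. f (?e i)) = (\<Sum>\<alpha>\<in>?e ` {..<n}. f \<alpha>)"
      by (simp add: sum.reindex)
    also have "\<dots> \<le> C"
      using bij by (intro le) (auto simp: bij_betw_def)
    finally show "(\<Sum>i<n. f (?e i)) \<le> C" .
  qed
  finally show ?thesis .
qed

section \<open>Duality for Banach ideal spaces\<close>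

lemma topological_dualD:
  assumes "\<phi> \<in> carrier (topological_dual F)"
  shows "\<phi> \<in> extensional (carrier F)"
    and "f \<in> carrier F \<Longrightarrow> g \<in> carrier F \<Longrightarrow> \<phi> (vadd F f g) = \<phi> f + \<phi> g"
    and "f \<in> carrier F \<Longrightarrow> \<phi> (vscale F c f) = c * \<phi> f"
    and "\<exists>C. \<forall>f\<in>carrier F. \<bar>\<phi> f\<bar> \<le> C * vnorm F f"
  using assms by (simp_all add: topological_dual_def)

lemma dual_ball_bdd_above:
  assumes "\<phi> \<in> carrier (topological_dual F)"
    and "\<And>f. f \<in> carrier F \<Longrightarrow> 0 \<le> vnorm F f"
  shows "bdd_above ((\<lambda>f. \<bar>\<phi> f\<bar>) ` {f \<in> carrier F. vnorm F f \<le> 1})"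
proof -
  obtain C where C: "\<And>f. f \<in> carrier F \<Longrightarrow> \<bar>\<phi> f\<bar> \<le> C * vnorm F f"
    using topological_dualD(4)[OF assms(1)] by blast
  have "\<bar>\<phi> f\<bar> \<le> \<bar>C\<bar>" if "f \<in> carrier F" "vnorm F f \<le> 1" for f
  proof -
    have "\<bar>\<phi> f\<bar> \<le> C * vnorm F f" by (rule C) fact
    also have "\<dots> \<le> \<bar>C\<bar> * 1"
      using that assms(2) by (intro mult_mono) auto
    finally show ?thesis by simp
  qed
  then show ?thesis by (intro bdd_aboveI2) auto
qed

lemma dual_norm_upper:
  assumes "\<phi> \<in> carrier (topological_dual F)"
    and "\<And>f. f \<in> carrier F \<Longrightarrow> 0 \<le> vnorm F f"
    and "f \<in> carrier F" "vnorm F f \<le> 1"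
  shows "\<bar>\<phi> f\<bar> \<le> vnorm (topological_dual F) \<phi>"
  using cSUP_upper[OF _ dual_ball_bdd_above[OF assms(1,2)], of f] assms(3,4)
  by (simp add: topological_dual_def)

context banach_ideal_space
begin

lemma vadd_eq: "vadd X = (\<lambda>f g x. f x + g x)"
  using arg_cong[OF operations, of vadd] by (simp add: L0_lattice_def)

lemma vscale_eq: "vscale X = (\<lambda>c f x. c * f x)"
  using arg_cong[OF operations, of vscale] by (simp add: L0_lattice_def)

lemma vle_eq: "vle X = (\<lambda>f g. AE x in M. f x \<le> g x)"
  using arg_cong[OF operations, of vle] by (simp add: L0_lattice_def)

lemma vzero_eq: "vzero X = (\<lambda>x. 0)"
  using arg_cong[OF operations, of vzero] by (simp add: L0_lattice_def)

lemma in_borel: "f \<in> carrier X \<Longrightarrow> f \<in> borel_measurable M"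
  using measurable by blast

text \<open>
  The ideal property applied in both directions: functions stand for their classes, so every
  construction below may be changed on a null set.
\<close>

lemma AE_eq_carrier_norm:
  assumes "f \<in> carrier X" "f' \<in> borel_measurable M" "AE x in M. f' x = f x"
  shows "f' \<in> carrier X" "vnorm X f' = vnorm X f"
proof -
  have "AE x in M. \<bar>f' x\<bar> \<le> \<bar>f x\<bar>" "AE x in M. \<bar>f x\<bar> \<le> \<bar>f' x\<bar>"
    using assms(3) by (auto elim!: eventually_mono)
  then show "f' \<in> carrier X" "vnorm X f' = vnorm X f"
    using ideal[of f' f] ideal[of f f'] assms in_borel[OF assms(1)] by (auto intro: antisym)
qed

lemma norm_zero: "vnorm X (\<lambda>x. 0) = 0"
  using norm_eq_0[OF zero_closed] by simp

lemma unit_ball_nonempty: "{f \<in> carrier X. vnorm X f \<le> 1} \<noteq> {}"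
  using zero_closed norm_zero by force

lemma unit_ball_normalize:
  assumes "f \<in> carrier X" "vnorm X f \<le> c" "c > 0"
  shows "(\<lambda>x. inverse c * f x) \<in> {f \<in> carrier X. vnorm X f \<le> 1}"
proof -
  have "inverse c * vnorm X f \<le> 1" using assms(2,3) by (simp add: divide_simps)
  then show ?thesis
    using assms scale_closed[OF assms(1), of "inverse c"] norm_scale[OF assms(1), of "inverse c"]
    by simp
qed

lemma koethe_dual_norm_upper:
  assumes "f \<in> carrier X" "vnorm X f \<le> 1"
  shows "(\<integral>\<^sup>+ x. ennreal \<bar>f x * g x\<bar> \<partial>M) \<le> koethe_dual_norm M X g"
  unfolding koethe_dual_norm_def using assms by (intro SUP_upper) auto

text \<open>
  The bound also holds with an infinite dual norm: if \<open>vnorm X f = 0\<close>, then \<open>f\<close> vanishes almost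
  everywhere and \<open>0 * \<infinity> = 0\<close>; otherwise \<open>f\<close> is normalized.
\<close>

lemma koethe_hoelder:
  assumes f: "f \<in> carrier X" and g: "g \<in> borel_measurable M"
  shows "(\<integral>\<^sup>+ x. ennreal \<bar>f x * g x\<bar> \<partial>M) \<le> ennreal (vnorm X f) * koethe_dual_norm M X g"
proof (cases "vnorm X f = 0")
  case True
  then have "AE x in M. f x = 0" using norm_eq_0[OF f] by simp
  then have "(\<integral>\<^sup>+ x. ennreal \<bar>f x * g x\<bar> \<partial>M) = (\<integral>\<^sup>+ x. 0 \<partial>M)"
    by (intro nn_integral_cong_AE) (auto elim!: eventually_mono)
  then show ?thesis by simp
next
  case False
  let ?c = "vnorm X f"
  have c: "?c > 0" using False norm_nonneg[OF f] by simp
  note [measurable] = in_borel[OF f] g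
  have b: "(\<lambda>x. inverse ?c * f x) \<in> {f \<in> carrier X. vnorm X f \<le> 1}"
    using unit_ball_normalize[OF f _ c] by simp
  have "(\<integral>\<^sup>+ x. ennreal \<bar>f x * g x\<bar> \<partial>M)
      = (\<integral>\<^sup>+ x. ennreal ?c * ennreal \<bar>(inverse ?c * f x) * g x\<bar> \<partial>M)"
    using c by (intro nn_integral_cong) (simp add: abs_mult flip: ennreal_mult)
  also have "\<dots> = ennreal ?c * (\<integral>\<^sup>+ x. ennreal \<bar>(inverse ?c * f x) * g x\<bar> \<partial>M)"
    by (rule nn_integral_cmult) measurable
  also have "\<dots> \<le> ennreal ?c * koethe_dual_norm M X g"
    using b by (intro mult_left_mono koethe_dual_norm_upper) auto
  finally show ?thesis .
qed

lemma functional_le: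
  assumes \<phi>: "\<phi> \<in> carrier (topological_dual X)" and f: "f \<in> carrier X"
  shows "\<bar>\<phi> f\<bar> \<le> vnorm (topological_dual X) \<phi> * vnorm X f"
proof (cases "vnorm X f = 0")
  case True
  then show ?thesis using topological_dualD(4)[OF \<phi>] f by fastforce
next
  case False
  let ?c = "vnorm X f"
  have c: "?c > 0" using False norm_nonneg[OF f] by simp
  have b: "(\<lambda>x. inverse ?c * f x) \<in> {f \<in> carrier X. vnorm X f \<le> 1}"
    using unit_ball_normalize[OF f _ c] by simp
  then have "\<bar>\<phi> (\<lambda>x. inverse ?c * f x)\<bar> \<le> vnorm (topological_dual X) \<phi>"
    by (intro dual_norm_upper[OF \<phi>] norm_nonneg) auto
  moreover have "\<phi> (\<lambda>x. inverse ?c * f x) = inverse ?c * \<phi> f"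
    using topological_dualD(3)[OF \<phi> f] by (simp add: vscale_eq)
  ultimately have "inverse ?c * \<bar>\<phi> f\<bar> \<le> vnorm (topological_dual X) \<phi>"
    using c by (simp add: abs_mult)
  then show ?thesis using c by (simp add: divide_simps)
qed

lemma dual_norm_nonneg:
  assumes \<phi>: "\<phi> \<in> carrier (topological_dual X)"
  shows "0 \<le> vnorm (topological_dual X) \<phi>"
  using dual_norm_upper[OF \<phi> norm_nonneg zero_closed] norm_zero by simp

lemma functional_AE_cong:
  assumes \<phi>: "\<phi> \<in> carrier (topological_dual X)" and f: "f \<in> carrier X"
    and "f' \<in> borel_measurable M" "AE x in M. f' x = f x"
  shows "\<phi> f' = \<phi> f"
proof -
  have f': "f' \<in> carrier X" by (rule AE_eq_carrier_norm) fact+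
  have d: "(\<lambda>x. f' x + -1 * f x) \<in> carrier X"
    by (intro add_closed scale_closed f f')
  have "vnorm X (\<lambda>x. f' x + -1 * f x) = 0"
    using norm_eq_0[OF d] assms(4) by simp
  then have "\<phi> (\<lambda>x. f' x + -1 * f x) = 0"
    using functional_le[OF \<phi> d] by simp
  moreover have "\<phi> (\<lambda>x. f' x + -1 * f x) = \<phi> f' + \<phi> (\<lambda>x. -1 * f x)"
    using topological_dualD(2)[OF \<phi> f' scale_closed[OF f, of "-1"]] by (simp add: vadd_eq)
  moreover have "\<phi> (\<lambda>x. -1 * f x) = -1 * \<phi> f"
    using topological_dualD(3)[OF \<phi> f, of "-1"] by (simp add: vscale_eq)
  ultimately show ?thesis by simp
qed

text \<open>
  Passes from the real supremum defining the dual norm to one in \<^typ>\<open>ennreal\<close>, where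
  \<open>sum_SUP_le\<close> applies and no boundedness has to be carried along.
\<close>

lemma ennreal_dual_norm_le_SUP:
  assumes \<phi>: "\<phi> \<in> carrier (topological_dual X)"
  shows "ennreal (vnorm (topological_dual X) \<phi>)
    \<le> (SUP f\<in>{f \<in> carrier X. vnorm X f \<le> 1}. ennreal \<bar>\<phi> f\<bar>)" (is "_ \<le> ?S")
proof (cases "?S = top")
  case False
  have "vnorm (topological_dual X) \<phi> \<le> enn2real ?S"
    unfolding topological_dual_def normed_lattice.simps
  proof (rule cSUP_least[OF unit_ball_nonempty])
    fix f assume "f \<in> {f \<in> carrier X. vnorm X f \<le> 1}"
    then have "ennreal \<bar>\<phi> f\<bar> \<le> ?S" by (rule SUP_upper)
    moreover have "?S < top" using False by (simp only: top.not_eq_extremum)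
    ultimately have "enn2real (ennreal \<bar>\<phi> f\<bar>) \<le> enn2real ?S" by (rule enn2real_mono)
    then show "\<bar>\<phi> f\<bar> \<le> enn2real ?S" by simp
  qed
  then have "ennreal (vnorm (topological_dual X) \<phi>) \<le> ennreal (enn2real ?S)"
    by (rule ennreal_leI)
  also have "\<dots> = ?S"
    using False by (intro ennreal_enn2real) (simp only: top.not_eq_extremum)
  finally show ?thesis .
next
  case True
  show ?thesis unfolding True by simp
qed

end

section \<open>Banach sequence spaces\<close>

locale banach_sequence_space = banach_ideal_space "count_space I" E for I :: "'i set" and E +
  assumes countable_I: "countable I"
begin

lemma ideal_pointwise:
  assumes "g \<in> carrier E" "\<And>\<alpha>. \<alpha> \<in> I \<Longrightarrow> \<bar>f \<alpha>\<bar> \<le> \<bar>g \<alpha>\<bar>"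
  shows "f \<in> carrier E" "vnorm E f \<le> vnorm E g"
  using ideal[of f g] assms by (auto simp: AE_count_space)

text \<open>
  On a finite set any sequence is dominated by a multiple of the strictly positive element.
\<close>

lemma finite_support_mem:
  assumes "finite F" "\<And>\<alpha>. \<alpha> \<in> I - F \<Longrightarrow> f \<alpha> = 0"
  shows "f \<in> carrier E"
proof -
  obtain w where w: "w \<in> carrier E" "\<And>\<alpha>. \<alpha> \<in> I \<Longrightarrow> w \<alpha> > 0"
    using strictly_positive by auto
  define K where "K = (\<Sum>\<alpha>\<in>F \<inter> I. \<bar>f \<alpha>\<bar> / w \<alpha>)"
  have nn: "\<bar>f \<alpha>\<bar> / w \<alpha> \<ge> 0" if "\<alpha> \<in> I" for \<alpha>
    using w(2)[OF that] by simp
  have K: "K \<ge> 0" unfolding K_def by (intro sum_nonneg nn) auto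
  have "\<bar>f \<alpha>\<bar> \<le> \<bar>K * w \<alpha>\<bar>" if \<alpha>: "\<alpha> \<in> I" for \<alpha>
  proof (cases "\<alpha> \<in> F")
    case True
    have "\<bar>f \<alpha>\<bar> / w \<alpha> \<le> K"
      unfolding K_def using assms(1) True \<alpha> nn by (intro member_le_sum) auto
    then show ?thesis using w(2)[OF \<alpha>] K by (simp add: divide_simps abs_mult)
  qed (use assms(2) \<alpha> in auto)
  then show ?thesis
    by (rule ideal_pointwise(1)[OF scale_closed[OF w(1)]])
qed

lemma unit_ball_positive_at:
  assumes "\<alpha> \<in> I"
  obtains e where "e \<in> carrier E" "vnorm E e \<le> 1" "e \<alpha> > 0"
proof -
  obtain w where w: "w \<in> carrier E" "\<And>\<alpha>. \<alpha> \<in> I \<Longrightarrow> w \<alpha> > 0"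
    using strictly_positive by auto
  let ?c = "vnorm E w + 1"
  have c: "?c > 0" using norm_nonneg[OF w(1)] by simp
  have "(\<lambda>\<alpha>. inverse ?c * w \<alpha>) \<in> {f \<in> carrier E. vnorm E f \<le> 1}"
    using c by (intro unit_ball_normalize w(1)) auto
  moreover have "inverse ?c * w \<alpha> > 0" using c w(2)[OF assms] by simp
  ultimately show ?thesis using that by blast
qed

text \<open>
  It suffices to test with finite sums, which is what makes gluing finitely many functions
  enough for every lower bound on a dual norm.
\<close>

lemma koethe_dual_norm_le:
  assumes "\<And>e F. e \<in> carrier E \<Longrightarrow> vnorm E e \<le> 1 \<Longrightarrow> finite F \<Longrightarrow> F \<subseteq> I \<Longrightarrow>
    (\<Sum>\<alpha>\<in>F. ennreal \<bar>e \<alpha>\<bar> * ennreal (k \<alpha>)) \<le> C"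
    and "\<And>\<alpha>. \<alpha> \<in> I \<Longrightarrow> 0 \<le> k \<alpha>"
  shows "koethe_dual_norm (count_space I) E k \<le> C"
  unfolding koethe_dual_norm_def
proof (intro SUP_least nn_integral_count_space_le[OF countable_I])
  fix e F assume e: "e \<in> {f \<in> carrier E. vnorm E f \<le> 1}" and F: "finite F" "F \<subseteq> I"
  have "(\<Sum>\<alpha>\<in>F. ennreal \<bar>e \<alpha> * k \<alpha>\<bar>) = (\<Sum>\<alpha>\<in>F. ennreal \<bar>e \<alpha>\<bar> * ennreal (k \<alpha>))"
    using assms(2) F by (intro sum.cong refl) (auto simp: abs_mult subset_iff ennreal_mult)
  then show "(\<Sum>\<alpha>\<in>F. ennreal \<bar>e \<alpha> * k \<alpha>\<bar>) \<le> C"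
    using assms(1)[of e F] e F by simp
qed

lemma finite_sum_le_koethe_norm:
  assumes u: "u \<in> carrier E" "\<And>\<alpha>. \<alpha> \<in> I \<Longrightarrow> 0 \<le> u \<alpha>"
    and k: "k \<in> carrier (koethe_dual (count_space I) E)" "\<And>\<alpha>. \<alpha> \<in> I \<Longrightarrow> 0 \<le> k \<alpha>"
    and F: "finite F" "F \<subseteq> I"
  shows "(\<Sum>\<alpha>\<in>F. k \<alpha> * u \<alpha>) \<le> vnorm (koethe_dual (count_space I) E) k * vnorm E u"
proof -
  let ?N = "koethe_dual_norm (count_space I) E k"
  have fin: "?N < \<infinity>" using k(1) by (simp add: koethe_dual_def L0_lattice_def)
  have "ennreal (\<Sum>\<alpha>\<in>F. k \<alpha> * u \<alpha>) = (\<Sum>\<alpha>\<in>F. ennreal (k \<alpha> * u \<alpha>))"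
    using u(2) k(2) F by (subst sum_ennreal) (auto simp: subset_iff)
  also have "\<dots> = (\<Sum>\<alpha>\<in>F. ennreal \<bar>u \<alpha> * k \<alpha>\<bar>)"
    using u(2) k(2) F by (intro sum.cong refl arg_cong[of _ _ ennreal]) (auto simp: subset_iff)
  also have "\<dots> \<le> (\<integral>\<^sup>+\<alpha>. ennreal \<bar>u \<alpha> * k \<alpha>\<bar> \<partial>count_space I)"
    by (rule sum_le_nn_integral_count_space) fact+
  also have "\<dots> \<le> ennreal (vnorm E u) * ?N"
    by (rule koethe_hoelder[OF u(1)]) simp
  also have "\<dots> = ennreal (vnorm E u * enn2real ?N)"
    using fin norm_nonneg[OF u(1)] by (simp add: ennreal_mult)
  finally have "(\<Sum>\<alpha>\<in>F. k \<alpha> * u \<alpha>) \<le> vnorm E u * enn2real ?N"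
    using norm_nonneg[OF u(1)] by (subst (asm) ennreal_le_iff) auto
  then show ?thesis by (simp add: koethe_dual_def L0_lattice_def mult.commute)
qed

text \<open>
  Removing the first \<open>n\<close> indices of an enumeration of \<open>I\<close> gives a sequence that decreases to
  \<open>0\<close>, so its norms tend to \<open>0\<close>; removing more indices only shrinks the norm.
\<close>

lemma order_continuous_tail:
  assumes oc: "order_continuous E" and u: "u \<in> carrier E" "\<And>\<alpha>. \<alpha> \<in> I \<Longrightarrow> 0 \<le> u \<alpha>"
    and "\<epsilon> > 0"
  obtains F0 where "finite F0" "F0 \<subseteq> I"
    "\<And>F. F0 \<subseteq> F \<Longrightarrow> vnorm E (\<lambda>\<alpha>. if \<alpha> \<in> F then 0 else u \<alpha>) < \<epsilon>"
proof -
  define P where "P n = {\<alpha> \<in> I. to_nat_on I \<alpha> < n}" for n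
  define s where "s n = (\<lambda>\<alpha>. if \<alpha> \<in> P n then 0 else u \<alpha>)" for n
  have tail: "(\<lambda>\<alpha>. if \<alpha> \<in> F then 0 else u \<alpha>) \<in> carrier E" for F
    using u by (intro ideal_pointwise(1)[OF u(1)]) auto
  have "(\<lambda>n. vnorm E (s n)) \<longlonglongrightarrow> 0"
  proof (rule oc[unfolded order_continuous_def, rule_format])
    show "s n \<in> carrier E" for n unfolding s_def by (rule tail)
    show "vle E (s (Suc n)) (s n)" "vle E (vzero E) (s n)" for n
      using u(2) by (auto simp: vle_eq vzero_eq AE_count_space s_def P_def)
    fix h assume h: "\<And>n. vle E h (s n)"
    have "h \<alpha> \<le> 0" if "\<alpha> \<in> I" for \<alpha>
      using h[of "Suc (to_nat_on I \<alpha>)"] that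
      by (auto simp: vle_eq AE_count_space s_def P_def dest!: bspec[of _ _ \<alpha>])
    then show "vle E h (vzero E)"
      by (auto simp: vle_eq vzero_eq AE_count_space)
  qed
  then obtain n where n: "vnorm E (s n) < \<epsilon>"
    using \<open>\<epsilon> > 0\<close> norm_nonneg by (metis LIMSEQ_D le_refl real_norm_def diff_zero abs_less_iff)
  show ?thesis
  proof (rule that)
    have "inj_on (to_nat_on I) (P n)"
      using inj_on_to_nat_on[OF countable_I] by (auto simp: P_def intro: inj_on_subset)
    moreover have "to_nat_on I ` P n \<subseteq> {..<n}" by (auto simp: P_def)
    ultimately show "finite (P n)" by (meson finite_lessThan inj_on_finite)
    show "P n \<subseteq> I" by (auto simp: P_def)
    fix F assume "P n \<subseteq> F"
    then have "vnorm E (\<lambda>\<alpha>. if \<alpha> \<in> F then 0 else u \<alpha>) \<le> vnorm E (s n)"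
      using u tail unfolding s_def by (intro ideal_pointwise(2)) auto
    with n show "vnorm E (\<lambda>\<alpha>. if \<alpha> \<in> F then 0 else u \<alpha>) < \<epsilon>" by simp
  qed
qed

end

section \<open>Partitions and the Koethe-Herz space\<close>

locale koethe_herz_family = banach_sequence_space I E for I :: "'i set" and E +
  fixes M :: "'a measure" and A :: "'i \<Rightarrow> 'a set" and X :: "'i \<Rightarrow> ('a \<Rightarrow> real) normed_lattice"
  assumes partition: "measurable_partition M I A"
    and component: "\<And>\<alpha>. \<alpha> \<in> I \<Longrightarrow> banach_ideal_space (restrict_space M (A \<alpha>)) (X \<alpha>)"
begin

abbreviation "R \<alpha> \<equiv> restrict_space M (A \<alpha>)"
abbreviation "H \<equiv> koethe_herz M I A E X"
abbreviation "norms f \<equiv> (\<lambda>\<alpha>. vnorm (X \<alpha>) (cut_off A \<alpha> f))"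

lemma A_sets [measurable]: "\<alpha> \<in> I \<Longrightarrow> A \<alpha> \<in> sets M"
  using partition by (simp add: measurable_partition_def)

lemma A_int_space: "\<alpha> \<in> I \<Longrightarrow> A \<alpha> \<inter> space M \<in> sets M"
  using A_sets by auto

lemma AE_R_iff: "\<alpha> \<in> I \<Longrightarrow> (AE x in R \<alpha>. P x) \<longleftrightarrow> (AE x in M. x \<in> A \<alpha> \<longrightarrow> P x)"
  by (rule AE_restrict_space_iff[OF A_int_space])

lemma AE_not_both:
  assumes "\<alpha> \<in> I" "\<beta> \<in> I"
  shows "AE x in M. \<alpha> \<noteq> \<beta> \<longrightarrow> \<not> (x \<in> A \<alpha> \<and> x \<in> A \<beta>)"
proof (cases "\<alpha> = \<beta>")
  case False
  then have "A \<alpha> \<inter> A \<beta> \<in> null_sets M"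
    using assms partition A_sets by (intro null_setsI) (auto simp: measurable_partition_def)
  then show ?thesis by (auto dest: AE_not_in)
qed simp

lemma cut_off_measurable:
  assumes "\<alpha> \<in> I" "f \<in> borel_measurable (R \<alpha>)"
  shows "cut_off A \<alpha> f \<in> borel_measurable M"
  using assms borel_measurable_restrict_space_iff[OF A_int_space[OF assms(1)], of f]
  by (simp add: cut_off_def mult.commute)

lemma cut_off_measurable_R:
  assumes "\<alpha> \<in> I" "\<beta> \<in> I" "f \<in> borel_measurable (R \<alpha>)"
  shows "cut_off A \<alpha> f \<in> borel_measurable (R \<beta>)"
  by (intro measurable_restrict_space1 cut_off_measurable assms)

lemma restrict_measurable: "f \<in> borel_measurable M \<Longrightarrow> f \<in> borel_measurable (R \<alpha>)"
  by (rule measurable_restrict_space1)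

lemma AE_cut_off: "\<alpha> \<in> I \<Longrightarrow> AE x in R \<alpha>. cut_off A \<alpha> f x = f x"
  by (simp add: AE_R_iff cut_off_def)

lemma cut_off_idem [simp]: "cut_off A \<alpha> (cut_off A \<alpha> f) = cut_off A \<alpha> f"
  by (auto simp: cut_off_def fun_eq_iff split: split_indicator)

text \<open>
  Countably many null sets \<open>A \<alpha> \<inter> A \<beta>\<close> are negligible together, so almost every point lies in
  exactly one \<open>A \<alpha>\<close>; countability of \<open>I\<close> is also what permits the exchange of sum and integral.
\<close>

lemma nn_integral_partition:
  assumes [measurable]: "h \<in> borel_measurable M"
  shows "(\<integral>\<^sup>+x. h x \<partial>M) = (\<integral>\<^sup>+\<alpha>. (\<integral>\<^sup>+x. h x \<partial>R \<alpha>) \<partial>count_space I)"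
proof -
  have "AE x in M. \<forall>\<alpha>\<in>I. \<forall>\<beta>\<in>I. \<alpha> \<noteq> \<beta> \<longrightarrow> \<not> (x \<in> A \<alpha> \<and> x \<in> A \<beta>)"
    using AE_not_both by (simp only: AE_ball_countable[OF countable_I]) blast
  moreover have "AE x in M. x \<in> (\<Union>\<alpha>\<in>I. A \<alpha>)"
    using partition by (simp add: measurable_partition_def)
  ultimately have "AE x in M. h x = (\<integral>\<^sup>+\<alpha>. h x * indicator (A \<alpha>) x \<partial>count_space I)"
  proof eventually_elim
    case (elim x)
    then obtain \<beta> where "\<beta> \<in> I" "x \<in> A \<beta>" by auto
    with elim show ?case
      by (subst nn_integral_count_space'[where A = "{\<beta>}"]) (auto simp: indicator_def)
  qed
  then have "(\<integral>\<^sup>+x. h x \<partial>M) = (\<integral>\<^sup>+x. (\<integral>\<^sup>+\<alpha>. h x * indicator (A \<alpha>) x \<partial>count_space I) \<partial>M)"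
    by (rule nn_integral_cong_AE)
  also have "\<dots> = (\<integral>\<^sup>+\<alpha>. (\<integral>\<^sup>+x. h x * indicator (A \<alpha>) x \<partial>M) \<partial>count_space I)"
    by (rule nn_integral_count_space_nn_integral[OF countable_I]) measurable
  also have "\<dots> = (\<integral>\<^sup>+\<alpha>. (\<integral>\<^sup>+x. h x \<partial>R \<alpha>) \<partial>count_space I)"
    by (intro nn_integral_cong) (simp add: nn_integral_restrict_space A_int_space)
  finally show ?thesis .
qed

lemma H_mem_iff:
  "f \<in> carrier H \<longleftrightarrow> f \<in> borel_measurable M \<and> (\<forall>\<alpha>\<in>I. cut_off A \<alpha> f \<in> carrier (X \<alpha>)) \<and> norms f \<in> carrier E"
  by (simp add: koethe_herz_def L0_lattice_def)

lemma H_ops: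
  "vadd H = (\<lambda>f g x. f x + g x)" "vscale H = (\<lambda>c f x. c * f x)" "vnorm H f = vnorm E (norms f)"
  by (simp_all add: koethe_herz_def L0_lattice_def)

lemma norms_nonneg: "f \<in> carrier H \<Longrightarrow> \<alpha> \<in> I \<Longrightarrow> 0 \<le> norms f \<alpha>"
  by (simp add: H_mem_iff banach_ideal_space.norm_nonneg[OF component])

lemma H_norm_nonneg: "f \<in> carrier H \<Longrightarrow> 0 \<le> vnorm H f"
  by (simp add: H_mem_iff H_ops norm_nonneg)

lemma H_add:
  assumes f: "f \<in> carrier H" and g: "g \<in> carrier H"
  shows "(\<lambda>x. f x + g x) \<in> carrier H"
proof -
  have eq: "cut_off A \<alpha> (\<lambda>x. f x + g x) = (\<lambda>x. cut_off A \<alpha> f x + cut_off A \<alpha> g x)" for \<alpha>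
    by (simp add: cut_off_def fun_eq_iff algebra_simps)
  have mem: "cut_off A \<alpha> (\<lambda>x. f x + g x) \<in> carrier (X \<alpha>)"
    and le: "\<bar>norms (\<lambda>x. f x + g x) \<alpha>\<bar> \<le> \<bar>norms f \<alpha> + norms g \<alpha>\<bar>" if "\<alpha> \<in> I" for \<alpha>
  proof -
    interpret X: banach_ideal_space "R \<alpha>" "X \<alpha>" using that by (rule component)
    have *: "cut_off A \<alpha> f \<in> carrier (X \<alpha>)" "cut_off A \<alpha> g \<in> carrier (X \<alpha>)"
      using f g that by (auto simp: H_mem_iff)
    show mem: "cut_off A \<alpha> (\<lambda>x. f x + g x) \<in> carrier (X \<alpha>)"
      unfolding eq by (rule X.add_closed[OF *])
    show "\<bar>norms (\<lambda>x. f x + g x) \<alpha>\<bar> \<le> \<bar>norms f \<alpha> + norms g \<alpha>\<bar>"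
      using X.norm_triangle[OF *] X.norm_nonneg[OF mem] unfolding eq by simp
  qed
  have "norms (\<lambda>x. f x + g x) \<in> carrier E"
    using f g by (intro ideal_pointwise(1)[OF add_closed le]) (auto simp: H_mem_iff)
  with mem f g show ?thesis by (auto simp: H_mem_iff)
qed

lemma H_scale:
  assumes f: "f \<in> carrier H"
  shows "(\<lambda>x. c * f x) \<in> carrier H"
proof -
  have eq: "cut_off A \<alpha> (\<lambda>x. c * f x) = (\<lambda>x. c * cut_off A \<alpha> f x)" for \<alpha>
    by (simp add: cut_off_def fun_eq_iff)
  have mem: "cut_off A \<alpha> (\<lambda>x. c * f x) \<in> carrier (X \<alpha>)"
    and norms: "norms (\<lambda>x. c * f x) \<alpha> = \<bar>c\<bar> * norms f \<alpha>" if "\<alpha> \<in> I" for \<alpha>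
  proof -
    interpret X: banach_ideal_space "R \<alpha>" "X \<alpha>" using that by (rule component)
    have *: "cut_off A \<alpha> f \<in> carrier (X \<alpha>)"
      using f that by (auto simp: H_mem_iff)
    show "cut_off A \<alpha> (\<lambda>x. c * f x) \<in> carrier (X \<alpha>)"
      unfolding eq by (rule X.scale_closed[OF *])
    show "norms (\<lambda>x. c * f x) \<alpha> = \<bar>c\<bar> * norms f \<alpha>"
      unfolding eq by (rule X.norm_scale[OF *])
  qed
  have "norms f \<in> carrier E" using f by (simp add: H_mem_iff)
  then have "(\<lambda>\<alpha>. \<bar>c\<bar> * norms f \<alpha>) \<in> carrier E" by (rule scale_closed)
  then have "norms (\<lambda>x. c * f x) \<in> carrier E"
    by (rule ideal_pointwise(1)) (simp only: norms)
  moreover have "(\<lambda>x. c * f x) \<in> borel_measurable M"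
    using f by (auto simp: H_mem_iff)
  ultimately show ?thesis using mem by (simp add: H_mem_iff)
qed

section \<open>Gluing finitely many components\<close>

definition glue :: "'i set \<Rightarrow> ('i \<Rightarrow> 'a \<Rightarrow> real) \<Rightarrow> 'a \<Rightarrow> real" where
  "glue F h = (\<lambda>x. \<Sum>\<alpha>\<in>F. cut_off A \<alpha> (h \<alpha>) x)"

text \<open>
  The summands with index other than \<open>\<beta>\<close> live on sets that meet \<open>A \<beta>\<close> in null sets only.
\<close>

lemma AE_glue:
  assumes F: "finite F" "F \<subseteq> I" and \<beta>: "\<beta> \<in> I"
  shows "AE x in R \<beta>. glue F h x = (if \<beta> \<in> F then h \<beta> x else 0)"
proof -
  have "AE x in M. \<forall>\<alpha>\<in>F. \<alpha> \<noteq> \<beta> \<longrightarrow> \<not> (x \<in> A \<alpha> \<and> x \<in> A \<beta>)"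
    using AE_not_both F(2) \<beta> by (simp only: AE_ball_countable[OF countable_finite[OF F(1)]]) blast
  then have "AE x in M. x \<in> A \<beta> \<longrightarrow> glue F h x = (if \<beta> \<in> F then h \<beta> x else 0)"
  proof (eventually_elim, intro impI)
    fix x assume x: "x \<in> A \<beta>" and "\<forall>\<alpha>\<in>F. \<alpha> \<noteq> \<beta> \<longrightarrow> \<not> (x \<in> A \<alpha> \<and> x \<in> A \<beta>)"
    then have "glue F h x = (\<Sum>\<alpha>\<in>F. if \<alpha> = \<beta> then h \<beta> x else 0)"
      unfolding glue_def by (intro sum.cong) (auto simp: cut_off_def)
    then show "glue F h x = (if \<beta> \<in> F then h \<beta> x else 0)"
      using F(1) by (simp add: sum.delta)
  qed
  then show ?thesis by (simp add: AE_R_iff \<beta>)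
qed

context
  fixes F h
  assumes F: "finite F" "F \<subseteq> I" and h: "\<And>\<alpha>. \<alpha> \<in> F \<Longrightarrow> h \<alpha> \<in> carrier (X \<alpha>)"
begin

lemma glue_measurable: "glue F h \<in> borel_measurable M"
  unfolding glue_def using F h banach_ideal_space.in_borel[OF component]
  by (intro borel_measurable_sum cut_off_measurable) auto

lemma glue_component:
  assumes \<beta>: "\<beta> \<in> I"
  shows "cut_off A \<beta> (glue F h) \<in> carrier (X \<beta>)"
    and "norms (glue F h) \<beta> = (if \<beta> \<in> F then vnorm (X \<beta>) (h \<beta>) else 0)"
proof -
  interpret X: banach_ideal_space "R \<beta>" "X \<beta>" using \<beta> by (rule component)
  let ?h = "\<lambda>x. if \<beta> \<in> F then h \<beta> x else 0"
  have m: "?h \<in> carrier (X \<beta>)" using h X.zero_closed by (cases "\<beta> \<in> F") simp_all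
  have c: "cut_off A \<beta> (glue F h) \<in> borel_measurable (R \<beta>)"
    by (intro cut_off_measurable_R restrict_measurable \<beta> glue_measurable)
  have ae: "AE x in R \<beta>. cut_off A \<beta> (glue F h) x = ?h x"
    using AE_cut_off[OF \<beta>, of "glue F h"] AE_glue[OF F \<beta>, of h] by eventually_elim simp
  show "cut_off A \<beta> (glue F h) \<in> carrier (X \<beta>)"
    by (rule X.AE_eq_carrier_norm[OF m c ae])
  show "norms (glue F h) \<beta> = (if \<beta> \<in> F then vnorm (X \<beta>) (h \<beta>) else 0)"
    using X.AE_eq_carrier_norm(2)[OF m c ae] X.norm_zero by simp
qed

lemma glue_mem: "glue F h \<in> carrier H"
proof -
  have "norms (glue F h) \<in> carrier E"
    using F(1) glue_component(2) by (intro finite_support_mem[of F]) auto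
  then show ?thesis
    using glue_measurable glue_component(1) by (simp add: H_mem_iff)
qed

lemma glue_norm_le:
  assumes e: "e \<in> carrier E" and le: "\<And>\<alpha>. \<alpha> \<in> F \<Longrightarrow> vnorm (X \<alpha>) (h \<alpha>) \<le> \<bar>e \<alpha>\<bar>"
  shows "vnorm H (glue F h) \<le> vnorm E e"
  unfolding H_ops
proof (rule ideal_pointwise(2)[OF e])
  fix \<alpha> assume "\<alpha> \<in> I"
  with glue_component(2)[OF this] norms_nonneg[OF glue_mem this] le[of \<alpha>]
  show "\<bar>norms (glue F h) \<alpha>\<bar> \<le> \<bar>e \<alpha>\<bar>" by (auto split: if_splits)
qed

end

text \<open>
  Extension by zero from \<open>A \<alpha>\<close> is gluing a single component. This embeds \<open>X \<alpha>\<close> into the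
  Koethe-Herz space.
\<close>

lemma glue_singleton: "glue {\<alpha>} (\<lambda>_. h) = cut_off A \<alpha> h"
  by (simp add: glue_def)

lemma cut_off_in_H: "\<alpha> \<in> I \<Longrightarrow> h \<in> carrier (X \<alpha>) \<Longrightarrow> cut_off A \<alpha> h \<in> carrier H"
  using glue_mem[of "{\<alpha>}" "\<lambda>_. h"] by (simp add: glue_singleton)

lemma functional_glue:
  assumes \<phi>: "\<phi> \<in> carrier (topological_dual H)"
    and F: "finite F" "F \<subseteq> I" and h: "\<And>\<alpha>. \<alpha> \<in> F \<Longrightarrow> h \<alpha> \<in> carrier (X \<alpha>)"
  shows "\<phi> (glue F h) = (\<Sum>\<alpha>\<in>F. \<phi> (cut_off A \<alpha> (h \<alpha>)))"
  using F h
proof (induction F rule: finite_induct)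
  case empty
  have z: "glue {} h \<in> carrier H" by (rule glue_mem) auto
  have "\<phi> (vscale H 0 (glue {} h)) = 0 * \<phi> (glue {} h)"
    by (rule topological_dualD(3)[OF \<phi> z])
  then show ?case by (simp add: H_ops glue_def)
next
  case (insert \<beta> F)
  have "cut_off A \<beta> (h \<beta>) \<in> carrier H" "glue F h \<in> carrier H"
    using insert by (auto intro!: cut_off_in_H glue_mem)
  from topological_dualD(2)[OF \<phi> this]
  have "\<phi> (glue (insert \<beta> F) h) = \<phi> (cut_off A \<beta> (h \<beta>)) + \<phi> (glue F h)"
    using insert.hyps by (simp add: H_ops glue_def)
  then show ?case using insert by simp
qed

section \<open>The components of a functional\<close>

definition components :: "(('a \<Rightarrow> real) \<Rightarrow> real) \<Rightarrow> 'i \<Rightarrow> ('a \<Rightarrow> real) \<Rightarrow> real" where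
  "components \<phi> = (\<lambda>\<alpha>\<in>I. \<lambda>h\<in>carrier (X \<alpha>). \<phi> (cut_off A \<alpha> h))"

text \<open>
  The constant is that of \<open>\<phi>\<close> times the norm of the unit vector at \<open>\<alpha>\<close>, because extension by zero
  multiplies norms by the latter.
\<close>

lemma component_bounded:
  assumes \<phi>: "\<phi> \<in> carrier (topological_dual H)" and \<alpha>: "\<alpha> \<in> I"
  shows "components \<phi> \<alpha> \<in> carrier (topological_dual (X \<alpha>))"
proof -
  interpret X: banach_ideal_space "R \<alpha>" "X \<alpha>" using \<alpha> by (rule component)
  let ?\<delta> = "indicator {\<alpha>} :: 'i \<Rightarrow> real"
  have \<delta>: "?\<delta> \<in> carrier E" by (rule finite_support_mem[of "{\<alpha>}"]) auto
  obtain C where C: "\<And>f. f \<in> carrier H \<Longrightarrow> \<bar>\<phi> f\<bar> \<le> C * vnorm H f"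
    using topological_dualD(4)[OF \<phi>] by blast
  have "\<phi> (cut_off A \<alpha> (vadd (X \<alpha>) f g)) = \<phi> (cut_off A \<alpha> f) + \<phi> (cut_off A \<alpha> g)"
    if "f \<in> carrier (X \<alpha>)" "g \<in> carrier (X \<alpha>)" for f g
  proof -
    have "cut_off A \<alpha> (vadd (X \<alpha>) f g) = vadd H (cut_off A \<alpha> f) (cut_off A \<alpha> g)"
      by (simp add: X.vadd_eq H_ops cut_off_def fun_eq_iff algebra_simps)
    then show ?thesis using topological_dualD(2)[OF \<phi>] cut_off_in_H \<alpha> that by simp
  qed
  moreover have "\<phi> (cut_off A \<alpha> (vscale (X \<alpha>) c f)) = c * \<phi> (cut_off A \<alpha> f)"
    if "f \<in> carrier (X \<alpha>)" for c f
  proof -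
    have "cut_off A \<alpha> (vscale (X \<alpha>) c f) = vscale H c (cut_off A \<alpha> f)"
      by (simp add: X.vscale_eq H_ops cut_off_def fun_eq_iff)
    then show ?thesis using topological_dualD(3)[OF \<phi>] cut_off_in_H \<alpha> that by simp
  qed
  moreover have "\<bar>\<phi> (cut_off A \<alpha> f)\<bar> \<le> (\<bar>C\<bar> * vnorm E ?\<delta>) * vnorm (X \<alpha>) f"
    if f: "f \<in> carrier (X \<alpha>)" for f
  proof -
    have "\<bar>\<phi> (cut_off A \<alpha> f)\<bar> \<le> C * vnorm H (cut_off A \<alpha> f)"
      by (intro C cut_off_in_H \<alpha> f)
    also have "\<dots> \<le> \<bar>C\<bar> * vnorm H (cut_off A \<alpha> f)"
      by (intro mult_right_mono H_norm_nonneg cut_off_in_H \<alpha> f) auto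
    also have "\<bar>C\<bar> * vnorm H (cut_off A \<alpha> f) \<le> \<bar>C\<bar> * vnorm E (\<lambda>\<beta>. vnorm (X \<alpha>) f * ?\<delta> \<beta>)"
      using \<alpha> f \<delta> X.norm_nonneg[OF f] unfolding glue_singleton[symmetric]
      by (intro mult_left_mono glue_norm_le scale_closed) auto
    also have "\<dots> = \<bar>C\<bar> * (vnorm (X \<alpha>) f * vnorm E ?\<delta>)"
      using norm_scale[OF \<delta>] X.norm_nonneg[OF f] by simp
    finally show ?thesis by (simp add: ac_simps)
  qed
  ultimately have
    "\<forall>f\<in>carrier (X \<alpha>). \<forall>g\<in>carrier (X \<alpha>).
      components \<phi> \<alpha> (vadd (X \<alpha>) f g) = components \<phi> \<alpha> f + components \<phi> \<alpha> g"
    "\<forall>c. \<forall>f\<in>carrier (X \<alpha>). components \<phi> \<alpha> (vscale (X \<alpha>) c f) = c * components \<phi> \<alpha> f"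
    "\<forall>f\<in>carrier (X \<alpha>). \<bar>components \<phi> \<alpha> f\<bar> \<le> (\<bar>C\<bar> * vnorm E ?\<delta>) * vnorm (X \<alpha>) f"
    using \<alpha> X.add_closed X.scale_closed
    by (simp_all add: components_def X.vadd_eq X.vscale_eq)
  moreover have "components \<phi> \<alpha> \<in> extensional (carrier (X \<alpha>))"
    using \<alpha> by (simp add: components_def)
  ultimately show ?thesis
    unfolding topological_dual_def normed_lattice.simps by blast
qed

text \<open>
  Tests \<open>\<phi>\<close> on glued functions; the terms then add up to one value of \<open>\<phi>\<close> on its unit ball.
\<close>

lemma sum_component_norms_le:
  assumes \<phi>: "\<phi> \<in> carrier (topological_dual H)"
    and e: "e \<in> carrier E" "vnorm E e \<le> 1" and F: "finite F" "F \<subseteq> I"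
  shows "(\<Sum>\<alpha>\<in>F. ennreal \<bar>e \<alpha>\<bar> * ennreal (vnorm (topological_dual (X \<alpha>)) (components \<phi> \<alpha>)))
    \<le> ennreal (vnorm (topological_dual H) \<phi>)" (is "_ \<le> ?C")
proof -
  let ?B = "\<lambda>\<alpha>. {f \<in> carrier (X \<alpha>). vnorm (X \<alpha>) f \<le> 1}"
  have "(\<Sum>\<alpha>\<in>F. ennreal \<bar>e \<alpha>\<bar> * ennreal (vnorm (topological_dual (X \<alpha>)) (components \<phi> \<alpha>)))
    \<le> (\<Sum>\<alpha>\<in>F. ennreal \<bar>e \<alpha>\<bar> * (SUP f\<in>?B \<alpha>. ennreal \<bar>components \<phi> \<alpha> f\<bar>))"
    using F component component_bounded[OF \<phi>]
    by (intro sum_mono mult_left_mono banach_ideal_space.ennreal_dual_norm_le_SUP) auto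
  also have "\<dots> = 0 + (\<Sum>\<alpha>\<in>F. SUP f\<in>?B \<alpha>. ennreal \<bar>e \<alpha>\<bar> * ennreal \<bar>components \<phi> \<alpha> f\<bar>)"
    by (simp add: SUP_mult_left_ennreal)
  also have "\<dots> \<le> ?C"
  proof (rule sum_SUP_le[OF F(1)])
    fix \<alpha> assume "\<alpha> \<in> F"
    then show "?B \<alpha> \<noteq> {}"
      using F by (intro banach_ideal_space.unit_ball_nonempty[OF component]) auto
  next
    fix h assume h: "\<And>\<alpha>. \<alpha> \<in> F \<Longrightarrow> h \<alpha> \<in> ?B \<alpha>"
    \<comment> \<open>The sign makes every summand of \<open>\<phi> f\<close> nonnegative, so that nothing cancels.\<close>
    define c where "c \<alpha> = \<bar>e \<alpha>\<bar> * sgn (\<phi> (cut_off A \<alpha> (h \<alpha>)))" for \<alpha>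
    define f where "f = glue F (\<lambda>\<alpha> x. c \<alpha> * h \<alpha> x)"
    have ch: "(\<lambda>x. c \<alpha> * h \<alpha> x) \<in> carrier (X \<alpha>)" if "\<alpha> \<in> F" for \<alpha>
      using that F h by (intro banach_ideal_space.scale_closed[OF component]) auto
    have "vnorm (X \<alpha>) (\<lambda>x. c \<alpha> * h \<alpha> x) \<le> \<bar>e \<alpha>\<bar>" if "\<alpha> \<in> F" for \<alpha>
    proof -
      have "vnorm (X \<alpha>) (\<lambda>x. c \<alpha> * h \<alpha> x) = \<bar>c \<alpha>\<bar> * vnorm (X \<alpha>) (h \<alpha>)"
        using that F h by (intro banach_ideal_space.norm_scale[OF component]) auto
      also have "\<dots> \<le> \<bar>e \<alpha>\<bar> * 1"
        using h[OF that] F that banach_ideal_space.norm_nonneg[OF component]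
        by (intro mult_mono) (auto simp: c_def abs_mult abs_sgn_eq)
      finally show ?thesis by simp
    qed
    then have "vnorm H f \<le> 1"
      using glue_norm_le[OF F ch e(1)] e(2) unfolding f_def by force
    moreover have "f \<in> carrier H" unfolding f_def by (rule glue_mem[OF F ch])
    ultimately have "\<bar>\<phi> f\<bar> \<le> vnorm (topological_dual H) \<phi>"
      by (intro dual_norm_upper[OF \<phi> H_norm_nonneg])
    moreover have "\<phi> f = (\<Sum>\<alpha>\<in>F. \<bar>e \<alpha>\<bar> * \<bar>components \<phi> \<alpha> (h \<alpha>)\<bar>)"
    proof -
      have "\<phi> f = (\<Sum>\<alpha>\<in>F. \<phi> (cut_off A \<alpha> (\<lambda>x. c \<alpha> * h \<alpha> x)))"
        unfolding f_def by (rule functional_glue[OF \<phi> F ch])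
      also have "\<dots> = (\<Sum>\<alpha>\<in>F. \<bar>e \<alpha>\<bar> * \<bar>components \<phi> \<alpha> (h \<alpha>)\<bar>)"
      proof (intro sum.cong refl)
        fix \<alpha> assume \<alpha>: "\<alpha> \<in> F"
        have "cut_off A \<alpha> (\<lambda>x. c \<alpha> * h \<alpha> x) = vscale H (c \<alpha>) (cut_off A \<alpha> (h \<alpha>))"
          by (simp add: H_ops cut_off_def fun_eq_iff)
        moreover have "cut_off A \<alpha> (h \<alpha>) \<in> carrier H"
          using \<alpha> F h by (intro cut_off_in_H) auto
        ultimately have "\<phi> (cut_off A \<alpha> (\<lambda>x. c \<alpha> * h \<alpha> x)) = c \<alpha> * \<phi> (cut_off A \<alpha> (h \<alpha>))"
          using topological_dualD(3)[OF \<phi>] by simp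
        then show "\<phi> (cut_off A \<alpha> (\<lambda>x. c \<alpha> * h \<alpha> x)) = \<bar>e \<alpha>\<bar> * \<bar>components \<phi> \<alpha> (h \<alpha>)\<bar>"
          using \<alpha> F h by (simp add: c_def components_def subset_iff abs_sgn mult.commute mult.left_commute)
      qed
      finally show ?thesis .
    qed
    ultimately have "ennreal (\<Sum>\<alpha>\<in>F. \<bar>e \<alpha>\<bar> * \<bar>components \<phi> \<alpha> (h \<alpha>)\<bar>) \<le> ?C"
      by (intro ennreal_leI) linarith
    then show "0 + (\<Sum>\<alpha>\<in>F. ennreal \<bar>e \<alpha>\<bar> * ennreal \<bar>components \<phi> \<alpha> (h \<alpha>)\<bar>) \<le> ?C"
      by (simp add: ennreal_mult[symmetric] sum_ennreal)
  qed
  finally show ?thesis .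
qed


text \<open>
  Order continuity of \<open>E\<close> enters here: what remains of \<open>f\<close> after removing the pieces in \<open>F\<close> has
  for component norms the tail of the sequence \<open>norms f\<close>, which is small for large \<open>F\<close>.
\<close>

lemma functional_has_sum:
  assumes oc: "order_continuous E"
    and \<phi>: "\<phi> \<in> carrier (topological_dual H)" and f: "f \<in> carrier H"
  shows "((\<lambda>\<alpha>. components \<phi> \<alpha> (cut_off A \<alpha> f)) has_sum \<phi> f) I"
  unfolding has_sum_def tendsto_iff eventually_finite_subsets_at_top
proof (intro allI impI)
  fix \<epsilon> :: real assume \<epsilon>: "\<epsilon> > 0"
  obtain C where C: "\<And>f. f \<in> carrier H \<Longrightarrow> \<bar>\<phi> f\<bar> \<le> C * vnorm H f"
    using topological_dualD(4)[OF \<phi>] by blast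
  \<comment> \<open>\<open>C\<close> may vanish or be negative; a positive constant is needed as a denominator.\<close>
  let ?C = "\<bar>C\<bar> + 1"
  have u: "norms f \<in> carrier E" and cut: "\<And>\<alpha>. \<alpha> \<in> I \<Longrightarrow> cut_off A \<alpha> f \<in> carrier (X \<alpha>)"
    using f by (simp_all add: H_mem_iff)
  obtain F0 where F0: "finite F0" "F0 \<subseteq> I"
    and tail: "\<And>F. F0 \<subseteq> F \<Longrightarrow> vnorm E (\<lambda>\<alpha>. if \<alpha> \<in> F then 0 else norms f \<alpha>) < \<epsilon> / ?C"
    using order_continuous_tail[OF oc u norms_nonneg[OF f], of "\<epsilon> / ?C"] \<epsilon> by auto
  show "\<exists>F0. finite F0 \<and> F0 \<subseteq> I \<and> (\<forall>F. finite F \<and> F0 \<subseteq> F \<and> F \<subseteq> I \<longrightarrow>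
      dist (\<Sum>\<alpha>\<in>F. components \<phi> \<alpha> (cut_off A \<alpha> f)) (\<phi> f) < \<epsilon>)"
  proof (intro exI[of _ F0] conjI F0 allI impI; elim conjE)
    fix F assume F: "finite F" "F0 \<subseteq> F" "F \<subseteq> I"
    define p where "p = glue F (\<lambda>\<alpha>. cut_off A \<alpha> f)"
    define r where "r = (\<lambda>x. f x + -1 * p x)"
    have p: "p \<in> carrier H"
      unfolding p_def using F cut by (intro glue_mem) auto
    have r: "r \<in> carrier H"
      unfolding r_def by (intro H_add H_scale f p)
    have "\<phi> p = (\<Sum>\<alpha>\<in>F. \<phi> (cut_off A \<alpha> (cut_off A \<alpha> f)))"
      unfolding p_def using F cut by (intro functional_glue[OF \<phi>]) auto
    also have "\<dots> = (\<Sum>\<alpha>\<in>F. components \<phi> \<alpha> (cut_off A \<alpha> f))"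
      using F cut by (intro sum.cong) (auto simp: components_def)
    finally have \<phi>p: "\<phi> p = (\<Sum>\<alpha>\<in>F. components \<phi> \<alpha> (cut_off A \<alpha> f))" .
    have "\<phi> r = \<phi> f + -1 * \<phi> p"
      using topological_dualD(2)[OF \<phi> f H_scale[OF p, of "-1"]] topological_dualD(3)[OF \<phi> p, of "-1"]
      by (simp add: H_ops r_def)
    then have "dist (\<Sum>\<alpha>\<in>F. components \<phi> \<alpha> (cut_off A \<alpha> f)) (\<phi> f) = \<bar>\<phi> r\<bar>"
      by (simp add: dist_real_def \<phi>p)
    also have "\<dots> \<le> C * vnorm H r" by (rule C[OF r])
    also have "\<dots> \<le> ?C * vnorm H r"
      by (intro mult_right_mono H_norm_nonneg r) auto
    also have "\<dots> < ?C * (\<epsilon> / ?C)"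
    proof (rule mult_strict_left_mono)
      have "\<bar>norms r \<alpha>\<bar> \<le> \<bar>if \<alpha> \<in> F then 0 else norms f \<alpha>\<bar>" if \<alpha>: "\<alpha> \<in> I" for \<alpha>
      proof -
        interpret X: banach_ideal_space "R \<alpha>" "X \<alpha>" using \<alpha> by (rule component)
        have mr: "cut_off A \<alpha> r \<in> carrier (X \<alpha>)" using r \<alpha> by (simp add: H_mem_iff)
        let ?t = "\<lambda>x. if \<alpha> \<in> F then 0 else cut_off A \<alpha> f x"
        have t: "?t \<in> carrier (X \<alpha>)"
          using cut[OF \<alpha>] X.zero_closed by (cases "\<alpha> \<in> F") simp_all
        have "AE x in R \<alpha>. cut_off A \<alpha> r x = ?t x"
          using AE_glue[OF F(1,3) \<alpha>, of "\<lambda>\<alpha>. cut_off A \<alpha> f"] AE_cut_off[OF \<alpha>, of r]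
            AE_cut_off[OF \<alpha>, of f]
        proof eventually_elim
          case (elim x)
          then show ?case by (cases "\<alpha> \<in> F") (auto simp: r_def p_def)
        qed
        then have "norms r \<alpha> = vnorm (X \<alpha>) ?t"
          by (rule X.AE_eq_carrier_norm(2)[OF t X.in_borel[OF mr]])
        then show ?thesis using X.norm_zero by (cases "\<alpha> \<in> F") simp_all
      qed
      moreover have "(\<lambda>\<alpha>. if \<alpha> \<in> F then 0 else norms f \<alpha>) \<in> carrier E"
        by (rule ideal_pointwise(1)[OF u]) auto
      ultimately have "vnorm E (norms r) \<le> vnorm E (\<lambda>\<alpha>. if \<alpha> \<in> F then 0 else norms f \<alpha>)"
        by (intro ideal_pointwise(2))
      then show "vnorm H r < \<epsilon> / ?C"
        using tail[OF F(2)] by (simp add: H_ops)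
    qed auto
    also have "\<dots> = \<epsilon>" by simp
    finally show "dist (\<Sum>\<alpha>\<in>F. components \<phi> \<alpha> (cut_off A \<alpha> f)) (\<phi> f) < \<epsilon>" .
  qed
qed

section \<open>The topological dual\<close>

abbreviation "E' \<equiv> koethe_dual (count_space I) E"
abbreviation "D \<equiv> direct_sum I E' (\<lambda>\<alpha>. topological_dual (X \<alpha>))"
abbreviation "T \<equiv> pairing I A (carrier H)"

lemma koethe_E_mem_iff: "k \<in> carrier E' \<longleftrightarrow> koethe_dual_norm (count_space I) E k < \<infinity>"
  by (simp add: koethe_dual_def L0_lattice_def)

lemma koethe_E_norm: "vnorm E' k = enn2real (koethe_dual_norm (count_space I) E k)"
  by (simp add: koethe_dual_def L0_lattice_def)

lemma D_mem_iff:
  "g \<in> carrier D \<longleftrightarrow> g \<in> extensional I \<and> (\<forall>\<alpha>\<in>I. g \<alpha> \<in> carrier (topological_dual (X \<alpha>))) \<and>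
    (\<lambda>\<alpha>. vnorm (topological_dual (X \<alpha>)) (g \<alpha>)) \<in> carrier E'"
  by (auto simp: direct_sum_def PiE_def)

lemma D_norm: "vnorm D g = vnorm E' (\<lambda>\<alpha>. vnorm (topological_dual (X \<alpha>)) (g \<alpha>))"
  by (simp add: direct_sum_def)

text \<open>
  The Hoelder inequality in each \<open>X \<alpha>\<close>, then in \<open>E\<close>. The bound is uniform in \<open>F\<close> and so yields both
  absolute convergence of the pairing and its continuity.
\<close>

lemma pairing_finite_le:
  assumes g: "g \<in> carrier D" and f: "f \<in> carrier H" and F: "finite F" "F \<subseteq> I"
  shows "(\<Sum>\<alpha>\<in>F. \<bar>g \<alpha> (cut_off A \<alpha> f)\<bar>) \<le> vnorm D g * vnorm H f"
proof -
  have "(\<Sum>\<alpha>\<in>F. \<bar>g \<alpha> (cut_off A \<alpha> f)\<bar>)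
      \<le> (\<Sum>\<alpha>\<in>F. vnorm (topological_dual (X \<alpha>)) (g \<alpha>) * norms f \<alpha>)"
    using g f F by (intro sum_mono banach_ideal_space.functional_le[OF component])
      (auto simp: D_mem_iff H_mem_iff)
  also have "\<dots> \<le> vnorm D g * vnorm H f"
    unfolding D_norm H_ops using g f F
    by (intro finite_sum_le_koethe_norm norms_nonneg banach_ideal_space.dual_norm_nonneg[OF component])
       (auto simp: D_mem_iff H_mem_iff)
  finally show ?thesis .
qed

lemma pairing_abs_summable:
  assumes "g \<in> carrier D" "f \<in> carrier H"
  shows "(\<lambda>\<alpha>. \<bar>g \<alpha> (cut_off A \<alpha> f)\<bar>) summable_on I"
proof (rule nonneg_bdd_above_summable_on)
  show "bdd_above (sum (\<lambda>\<alpha>. \<bar>g \<alpha> (cut_off A \<alpha> f)\<bar>) ` {F. F \<subseteq> I \<and> finite F})"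
    using pairing_finite_le[OF assms]
    by (intro bdd_aboveI2[where M = "vnorm D g * vnorm H f"]) blast
qed simp

lemma pairing_summable:
  assumes "g \<in> carrier D" "f \<in> carrier H"
  shows "(\<lambda>\<alpha>. g \<alpha> (cut_off A \<alpha> f)) summable_on I"
  by (rule abs_summable_summable) (use pairing_abs_summable[OF assms] in simp)

lemma pairing_bound:
  assumes g: "g \<in> carrier D" and f: "f \<in> carrier H"
  shows "\<bar>T g f\<bar> \<le> vnorm D g * vnorm H f"
proof -
  have "\<bar>T g f\<bar> \<le> (\<Sum>\<^sub>\<infinity>\<alpha>\<in>I. \<bar>g \<alpha> (cut_off A \<alpha> f)\<bar>)"
    using norm_infsum_bound[of "\<lambda>\<alpha>. g \<alpha> (cut_off A \<alpha> f)" I] pairing_abs_summable[OF g f] f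
    by (simp add: pairing_def)
  also have "\<dots> \<le> vnorm D g * vnorm H f"
    by (intro infsum_le_finite_sums pairing_abs_summable pairing_finite_le g f)
  finally show ?thesis .
qed

lemma D_norm_nonneg: "0 \<le> vnorm D g"
  by (simp add: D_norm koethe_E_norm)

lemma pairing_in_dual:
  assumes g: "g \<in> carrier D"
  shows "T g \<in> carrier (topological_dual H)"
proof -
  have gd: "g \<alpha> \<in> carrier (topological_dual (X \<alpha>))" if "\<alpha> \<in> I" for \<alpha>
    using g that by (simp add: D_mem_iff)
  have "T g (vadd H f1 f2) = T g f1 + T g f2" if f: "f1 \<in> carrier H" "f2 \<in> carrier H" for f1 f2
  proof -
    have "g \<alpha> (cut_off A \<alpha> (\<lambda>x. f1 x + f2 x)) = g \<alpha> (cut_off A \<alpha> f1) + g \<alpha> (cut_off A \<alpha> f2)"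
      if \<alpha>: "\<alpha> \<in> I" for \<alpha>
    proof -
      interpret X: banach_ideal_space "R \<alpha>" "X \<alpha>" using \<alpha> by (rule component)
      have "cut_off A \<alpha> (\<lambda>x. f1 x + f2 x) = vadd (X \<alpha>) (cut_off A \<alpha> f1) (cut_off A \<alpha> f2)"
        by (simp add: X.vadd_eq cut_off_def fun_eq_iff algebra_simps)
      then show ?thesis
        using topological_dualD(2)[OF gd[OF \<alpha>]] f \<alpha> by (simp add: H_mem_iff)
    qed
    then have "(\<Sum>\<^sub>\<infinity>\<alpha>\<in>I. g \<alpha> (cut_off A \<alpha> (\<lambda>x. f1 x + f2 x)))
      = (\<Sum>\<^sub>\<infinity>\<alpha>\<in>I. g \<alpha> (cut_off A \<alpha> f1) + g \<alpha> (cut_off A \<alpha> f2))"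
      by (rule infsum_cong)
    also have "\<dots> = (\<Sum>\<^sub>\<infinity>\<alpha>\<in>I. g \<alpha> (cut_off A \<alpha> f1)) + (\<Sum>\<^sub>\<infinity>\<alpha>\<in>I. g \<alpha> (cut_off A \<alpha> f2))"
      by (intro infsum_add pairing_summable g f)
    finally show ?thesis
      using f H_add[OF f] by (simp add: pairing_def H_ops)
  qed
  moreover have "T g (vscale H c f) = c * T g f" if f: "f \<in> carrier H" for c f
  proof -
    have "g \<alpha> (cut_off A \<alpha> (\<lambda>x. c * f x)) = c * g \<alpha> (cut_off A \<alpha> f)"
      if \<alpha>: "\<alpha> \<in> I" for \<alpha>
    proof -
      interpret X: banach_ideal_space "R \<alpha>" "X \<alpha>" using \<alpha> by (rule component)
      have "cut_off A \<alpha> (\<lambda>x. c * f x) = vscale (X \<alpha>) c (cut_off A \<alpha> f)"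
        by (simp add: X.vscale_eq cut_off_def fun_eq_iff)
      then show ?thesis
        using topological_dualD(3)[OF gd[OF \<alpha>]] f \<alpha> by (simp add: H_mem_iff)
    qed
    then have "(\<Sum>\<^sub>\<infinity>\<alpha>\<in>I. g \<alpha> (cut_off A \<alpha> (\<lambda>x. c * f x)))
      = (\<Sum>\<^sub>\<infinity>\<alpha>\<in>I. c * g \<alpha> (cut_off A \<alpha> f))"
      by (rule infsum_cong)
    also have "\<dots> = c * (\<Sum>\<^sub>\<infinity>\<alpha>\<in>I. g \<alpha> (cut_off A \<alpha> f))"
      by (rule infsum_cmult_right')
    finally show ?thesis
      using f H_scale[OF f] by (simp add: pairing_def H_ops)
  qed
  moreover have "T g \<in> extensional (carrier H)" by (simp add: pairing_def)
  moreover note pairing_bound[OF g]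
  ultimately show ?thesis
    unfolding topological_dual_def normed_lattice.simps by blast
qed

text \<open>
  On the extension of \<open>h\<close> by zero from \<open>A \<alpha>\<close>, only the term of index \<open>\<alpha>\<close> of the pairing survives.
  Equality as total functions needs extensionality in both arguments of \<open>g\<close>.
\<close>

lemma components_pairing:
  assumes g: "g \<in> carrier D"
  shows "components (T g) = g"
proof
  fix \<alpha>
  show "components (T g) \<alpha> = g \<alpha>"
  proof (cases "\<alpha> \<in> I")
    case False
    have "g \<in> extensional I" using g by (simp add: D_mem_iff)
    then have "g \<alpha> = undefined" using False by (rule extensional_arb)
    then show ?thesis using False by (simp add: components_def)
  next
    case \<alpha>: True
    have gd: "g \<beta> \<in> carrier (topological_dual (X \<beta>))" if "\<beta> \<in> I" for \<beta>
      using g that by (simp add: D_mem_iff)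
    have "T g (cut_off A \<alpha> h) = g \<alpha> h" if h: "h \<in> carrier (X \<alpha>)" for h
    proof -
      have f: "cut_off A \<alpha> h \<in> carrier H" by (rule cut_off_in_H[OF \<alpha> h])
      have other: "g \<beta> (cut_off A \<beta> (cut_off A \<alpha> h)) = 0" if \<beta>: "\<beta> \<in> I - {\<alpha>}" for \<beta>
      proof -
        interpret X: banach_ideal_space "R \<beta>" "X \<beta>" using \<beta> component by simp
        have m: "cut_off A \<beta> (cut_off A \<alpha> h) \<in> carrier (X \<beta>)" using f \<beta> by (simp add: H_mem_iff)
        have "norms (cut_off A \<alpha> h) \<beta> = 0"
          using glue_component(2)[of "{\<alpha>}" "\<lambda>_. h" \<beta>] \<alpha> \<beta> h by (simp add: glue_singleton)
        then show ?thesis using X.functional_le[OF gd m] \<beta> by simp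
      qed
      have "T g (cut_off A \<alpha> h) = (\<Sum>\<^sub>\<infinity>\<beta>\<in>I. g \<beta> (cut_off A \<beta> (cut_off A \<alpha> h)))"
        using f by (simp add: pairing_def)
      also have "\<dots> = (\<Sum>\<^sub>\<infinity>\<beta>\<in>{\<alpha>}. g \<beta> (cut_off A \<beta> (cut_off A \<alpha> h)))"
        using other \<alpha> by (intro infsum_cong_neutral) auto
      also have "\<dots> = g \<alpha> (cut_off A \<alpha> h)" by simp
      also have "\<dots> = g \<alpha> h"
      proof -
        interpret X: banach_ideal_space "R \<alpha>" "X \<alpha>" using \<alpha> by (rule component)
        show ?thesis
          by (rule X.functional_AE_cong[OF gd[OF \<alpha>] h _ AE_cut_off[OF \<alpha>]])
             (intro cut_off_measurable_R \<alpha> X.in_borel h)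
      qed
      finally show ?thesis .
    qed
    then show ?thesis
      using \<alpha> by (intro extensionalityI[OF _ topological_dualD(1)[OF gd[OF \<alpha>]]])
        (simp_all add: components_def)
  qed
qed

lemma components_norm_le:
  assumes \<phi>: "\<phi> \<in> carrier (topological_dual H)"
  shows "koethe_dual_norm (count_space I) E (\<lambda>\<alpha>. vnorm (topological_dual (X \<alpha>)) (components \<phi> \<alpha>))
    \<le> ennreal (vnorm (topological_dual H) \<phi>)"
  using component_bounded[OF \<phi>]
  by (intro koethe_dual_norm_le sum_component_norms_le[OF \<phi>]
      banach_ideal_space.dual_norm_nonneg[OF component]) auto

lemma components_mem:
  assumes \<phi>: "\<phi> \<in> carrier (topological_dual H)"
  shows "components \<phi> \<in> carrier D"
proof -
  have "components \<phi> \<in> extensional I" by (simp add: components_def)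
  moreover have "(\<lambda>\<alpha>. vnorm (topological_dual (X \<alpha>)) (components \<phi> \<alpha>)) \<in> carrier E'"
    unfolding koethe_E_mem_iff using components_norm_le[OF \<phi>] by (simp add: le_less_trans)
  ultimately show ?thesis
    using component_bounded[OF \<phi>] by (simp add: D_mem_iff)
qed

lemma pairing_components:
  assumes oc: "order_continuous E" and \<phi>: "\<phi> \<in> carrier (topological_dual H)"
  shows "T (components \<phi>) = \<phi>"
proof
  fix f
  show "T (components \<phi>) f = \<phi> f"
    using infsumI[OF functional_has_sum[OF oc \<phi>, of f]] topological_dualD(1)[OF \<phi>]
    by (cases "f \<in> carrier H") (simp_all add: pairing_def extensional_def)
qed

lemma H_zero: "(\<lambda>x. 0) \<in> carrier H" "vnorm H (\<lambda>x. 0) = 0"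
proof -
  have eq: "glue {} undefined = (\<lambda>x. 0)" by (simp add: glue_def)
  show z: "(\<lambda>x. 0) \<in> carrier H" using glue_mem[of "{}" undefined] by (simp add: eq)
  show "vnorm H (\<lambda>x. 0) = 0"
    using glue_norm_le[of "{}" undefined, OF _ _ _ zero_closed] H_norm_nonneg[OF z] norm_zero
    by (simp add: eq)
qed

lemma pairing_norm:
  assumes g: "g \<in> carrier D"
  shows "vnorm (topological_dual H) (T g) = vnorm D g"
proof (rule antisym)
  have "(SUP f\<in>{f \<in> carrier H. vnorm H f \<le> 1}. \<bar>T g f\<bar>) \<le> vnorm D g"
  proof (rule cSUP_least)
    show "{f \<in> carrier H. vnorm H f \<le> 1} \<noteq> {}" using H_zero by force
    fix f assume f: "f \<in> {f \<in> carrier H. vnorm H f \<le> 1}"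
    then have "\<bar>T g f\<bar> \<le> vnorm D g * vnorm H f" by (intro pairing_bound g) simp
    also have "\<dots> \<le> vnorm D g * 1"
      using f by (intro mult_left_mono D_norm_nonneg) simp
    finally show "\<bar>T g f\<bar> \<le> vnorm D g" by simp
  qed
  then show "vnorm (topological_dual H) (T g) \<le> vnorm D g"
    by (simp add: topological_dual_def)
  have "0 \<le> vnorm (topological_dual H) (T g)"
    using dual_norm_upper[OF pairing_in_dual[OF g] H_norm_nonneg H_zero(1)] H_zero(2) by simp
  then show "vnorm D g \<le> vnorm (topological_dual H) (T g)"
    using enn2real_mono[OF components_norm_le[OF pairing_in_dual[OF g]]]
    by (simp add: components_pairing[OF g] D_norm koethe_E_norm)
qed

lemma pairing_isometric_isomorphism:
  assumes oc: "order_continuous E"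
  shows "isometric_isomorphism T D (topological_dual H)"
  unfolding isometric_isomorphism_def
proof (intro conjI ballI allI)
  show "bij_betw T (carrier D) (carrier (topological_dual H))"
  proof (rule bij_betw_byWitness[where f' = components])
    show "\<forall>g\<in>carrier D. components (T g) = g" using components_pairing by blast
    show "\<forall>\<phi>\<in>carrier (topological_dual H). T (components \<phi>) = \<phi>"
      using pairing_components[OF oc] by blast
    show "T ` carrier D \<subseteq> carrier (topological_dual H)" using pairing_in_dual by blast
    show "components ` carrier (topological_dual H) \<subseteq> carrier D" using components_mem by blast
  qed
  show "vnorm (topological_dual H) (T g) = vnorm D g" if "g \<in> carrier D" for g
    by (rule pairing_norm[OF that])
  fix g assume g: "g \<in> carrier D"
  show "T (vscale D c g) = vscale (topological_dual H) c (T g)" for c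
  proof
    fix f
    have "(\<Sum>\<^sub>\<infinity>\<alpha>\<in>I. vscale D c g \<alpha> (cut_off A \<alpha> f)) = (\<Sum>\<^sub>\<infinity>\<alpha>\<in>I. c * g \<alpha> (cut_off A \<alpha> f))"
      if "f \<in> carrier H"
      using that by (intro infsum_cong) (simp add: direct_sum_def topological_dual_def H_mem_iff)
    then show "T (vscale D c g) f = vscale (topological_dual H) c (T g) f"
      by (simp add: pairing_def topological_dual_def infsum_cmult_right')
  qed
  fix h assume h: "h \<in> carrier D"
  show "T (vadd D g h) = vadd (topological_dual H) (T g) (T h)"
  proof
    fix f
    have "(\<Sum>\<^sub>\<infinity>\<alpha>\<in>I. vadd D g h \<alpha> (cut_off A \<alpha> f))
        = (\<Sum>\<^sub>\<infinity>\<alpha>\<in>I. g \<alpha> (cut_off A \<alpha> f)) + (\<Sum>\<^sub>\<infinity>\<alpha>\<in>I. h \<alpha> (cut_off A \<alpha> f))"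
      if f: "f \<in> carrier H"
    proof -
      have "(\<Sum>\<^sub>\<infinity>\<alpha>\<in>I. vadd D g h \<alpha> (cut_off A \<alpha> f))
          = (\<Sum>\<^sub>\<infinity>\<alpha>\<in>I. g \<alpha> (cut_off A \<alpha> f) + h \<alpha> (cut_off A \<alpha> f))"
        using f by (intro infsum_cong) (simp add: direct_sum_def topological_dual_def H_mem_iff)
      then show ?thesis
        by (simp add: infsum_add pairing_summable g h f)
    qed
    then show "T (vadd D g h) f = vadd (topological_dual H) (T g) (T h) f"
      by (simp add: pairing_def topological_dual_def)
  qed
qed

section \<open>The Koethe dual\<close>

abbreviation "K g \<equiv> (\<lambda>\<alpha>. koethe_dual_norm (R \<alpha>) (X \<alpha>) (cut_off A \<alpha> g))"

text \<open>
  The counterpart of \<open>sum_component_norms_le\<close> for integrals. Since absolute values are integrated,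
  the glued function is formed without sign corrections.
\<close>

lemma sum_koethe_norms_le:
  assumes g: "g \<in> borel_measurable M"
    and e: "e \<in> carrier E" "vnorm E e \<le> 1" and F: "finite F" "F \<subseteq> I"
  shows "(\<Sum>\<alpha>\<in>F. ennreal \<bar>e \<alpha>\<bar> * K g \<alpha>) \<le> koethe_dual_norm M H g" (is "_ \<le> ?C")
proof -
  let ?B = "\<lambda>\<alpha>. {f \<in> carrier (X \<alpha>). vnorm (X \<alpha>) f \<le> 1}"
  let ?J = "\<lambda>\<alpha> f. ennreal \<bar>e \<alpha>\<bar> * (\<integral>\<^sup>+x. ennreal \<bar>f x * cut_off A \<alpha> g x\<bar> \<partial>R \<alpha>)"
  have "(\<Sum>\<alpha>\<in>F. ennreal \<bar>e \<alpha>\<bar> * K g \<alpha>) = 0 + (\<Sum>\<alpha>\<in>F. SUP f\<in>?B \<alpha>. ?J \<alpha> f)"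
    by (simp add: koethe_dual_norm_def SUP_mult_left_ennreal)
  also have "\<dots> \<le> ?C"
  proof (rule sum_SUP_le[OF F(1)])
    fix \<alpha> assume "\<alpha> \<in> F"
    then show "?B \<alpha> \<noteq> {}"
      using F by (intro banach_ideal_space.unit_ball_nonempty[OF component]) auto
  next
    fix h assume h: "\<And>\<alpha>. \<alpha> \<in> F \<Longrightarrow> h \<alpha> \<in> ?B \<alpha>"
    define f where "f = glue F (\<lambda>\<alpha> x. e \<alpha> * h \<alpha> x)"
    have eh: "(\<lambda>x. e \<alpha> * h \<alpha> x) \<in> carrier (X \<alpha>)" if "\<alpha> \<in> F" for \<alpha>
      using that F h by (intro banach_ideal_space.scale_closed[OF component]) auto
    have "vnorm (X \<alpha>) (\<lambda>x. e \<alpha> * h \<alpha> x) \<le> \<bar>e \<alpha>\<bar>" if "\<alpha> \<in> F" for \<alpha>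
    proof -
      have "vnorm (X \<alpha>) (\<lambda>x. e \<alpha> * h \<alpha> x) = \<bar>e \<alpha>\<bar> * vnorm (X \<alpha>) (h \<alpha>)"
        using that F h by (intro banach_ideal_space.norm_scale[OF component]) auto
      also have "\<dots> \<le> \<bar>e \<alpha>\<bar> * 1"
        using h[OF that] by (intro mult_left_mono) auto
      finally show ?thesis by simp
    qed
    then have f1: "vnorm H f \<le> 1"
      using glue_norm_le[OF F eh e(1)] e(2) unfolding f_def by force
    have f: "f \<in> carrier H" unfolding f_def by (rule glue_mem[OF F eh])
    note [measurable] = g
    have [measurable]: "f \<in> borel_measurable M" using f by (simp add: H_mem_iff)
    have "(\<Sum>\<alpha>\<in>F. ?J \<alpha> (h \<alpha>)) = (\<Sum>\<alpha>\<in>F. \<integral>\<^sup>+x. ennreal \<bar>f x * g x\<bar> \<partial>R \<alpha>)"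
    proof (intro sum.cong refl)
      fix \<alpha> assume \<alpha>: "\<alpha> \<in> F"
      then have \<alpha>I: "\<alpha> \<in> I" using F by auto
      interpret X: banach_ideal_space "R \<alpha>" "X \<alpha>" using \<alpha>I by (rule component)
      have [measurable]: "h \<alpha> \<in> borel_measurable (R \<alpha>)" using h[OF \<alpha>] X.in_borel by simp
      have [measurable]: "cut_off A \<alpha> g \<in> borel_measurable (R \<alpha>)"
        by (intro cut_off_measurable_R restrict_measurable g \<alpha>I)
      have "?J \<alpha> (h \<alpha>) = (\<integral>\<^sup>+x. ennreal \<bar>e \<alpha>\<bar> * ennreal \<bar>h \<alpha> x * cut_off A \<alpha> g x\<bar> \<partial>R \<alpha>)"
        by (rule nn_integral_cmult[symmetric]) measurable
      also have "\<dots> = (\<integral>\<^sup>+x. ennreal \<bar>f x * g x\<bar> \<partial>R \<alpha>)"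
      proof (rule nn_integral_cong_AE)
        show "AE x in R \<alpha>. ennreal \<bar>e \<alpha>\<bar> * ennreal \<bar>h \<alpha> x * cut_off A \<alpha> g x\<bar> = ennreal \<bar>f x * g x\<bar>"
          using AE_glue[OF F \<alpha>I, of "\<lambda>\<alpha> x. e \<alpha> * h \<alpha> x"] AE_cut_off[OF \<alpha>I, of g]
          by eventually_elim (simp add: f_def \<alpha> abs_mult ac_simps flip: ennreal_mult)
      qed
      finally show "?J \<alpha> (h \<alpha>) = (\<integral>\<^sup>+x. ennreal \<bar>f x * g x\<bar> \<partial>R \<alpha>)" .
    qed
    also have "\<dots> \<le> (\<integral>\<^sup>+\<alpha>. \<integral>\<^sup>+x. ennreal \<bar>f x * g x\<bar> \<partial>R \<alpha> \<partial>count_space I)"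
      by (rule sum_le_nn_integral_count_space[OF F])
    also have "\<dots> = (\<integral>\<^sup>+x. ennreal \<bar>f x * g x\<bar> \<partial>M)"
      by (rule nn_integral_partition[symmetric]) measurable
    also have "\<dots> \<le> ?C"
      unfolding koethe_dual_norm_def using f f1 by (intro SUP_upper) simp
    finally show "0 + (\<Sum>\<alpha>\<in>F. ?J \<alpha> (h \<alpha>)) \<le> ?C" by simp
  qed
  finally show ?thesis .
qed

text \<open>
  Needed before the component norms may be regarded as real numbers: a sequence of the unit ball
  of \<open>E\<close> that is positive at \<open>\<alpha>\<close> isolates the norm at \<open>\<alpha>\<close>.
\<close>

lemma component_koethe_norm_finite:
  assumes g: "g \<in> borel_measurable M" and fin: "koethe_dual_norm M H g < \<infinity>" and \<alpha>: "\<alpha> \<in> I"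
  shows "K g \<alpha> < \<infinity>"
proof -
  obtain e where e: "e \<in> carrier E" "vnorm E e \<le> 1" "e \<alpha> > 0"
    using unit_ball_positive_at[OF \<alpha>] by blast
  have "ennreal \<bar>e \<alpha>\<bar> * K g \<alpha> \<le> koethe_dual_norm M H g"
    using sum_koethe_norms_le[OF g e(1,2), of "{\<alpha>}"] \<alpha> by simp
  then have "ennreal \<bar>e \<alpha>\<bar> * K g \<alpha> < \<infinity>" using fin by (rule le_less_trans)
  then show ?thesis using e(3) by (auto simp: ennreal_mult_less_top)
qed

text \<open>
  An identity in \<^typ>\<open>ennreal\<close>, so that it compares membership in the two spaces as well as norms.
\<close>

lemma koethe_norm_eq:
  assumes g: "g \<in> borel_measurable M" and fin: "\<And>\<alpha>. \<alpha> \<in> I \<Longrightarrow> K g \<alpha> < \<infinity>"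
  shows "koethe_dual_norm M H g = koethe_dual_norm (count_space I) E (\<lambda>\<alpha>. enn2real (K g \<alpha>))"
proof (rule antisym)
  have K: "ennreal (enn2real (K g \<alpha>)) = K g \<alpha>" if "\<alpha> \<in> I" for \<alpha>
    using fin[OF that] by simp
  show "koethe_dual_norm (count_space I) E (\<lambda>\<alpha>. enn2real (K g \<alpha>)) \<le> koethe_dual_norm M H g"
  proof (rule koethe_dual_norm_le)
    fix e F assume *: "e \<in> carrier E" "vnorm E e \<le> 1" "finite F" "F \<subseteq> I"
    have "(\<Sum>\<alpha>\<in>F. ennreal \<bar>e \<alpha>\<bar> * ennreal (enn2real (K g \<alpha>))) = (\<Sum>\<alpha>\<in>F. ennreal \<bar>e \<alpha>\<bar> * K g \<alpha>)"
      using * K by (intro sum.cong) auto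
    also have "\<dots> \<le> koethe_dual_norm M H g" by (rule sum_koethe_norms_le[OF g *])
    finally show "(\<Sum>\<alpha>\<in>F. ennreal \<bar>e \<alpha>\<bar> * ennreal (enn2real (K g \<alpha>))) \<le> koethe_dual_norm M H g" .
  qed simp
  show "koethe_dual_norm M H g \<le> koethe_dual_norm (count_space I) E (\<lambda>\<alpha>. enn2real (K g \<alpha>))"
    unfolding koethe_dual_norm_def[of M H]
  proof (rule SUP_least)
    fix f assume "f \<in> {f \<in> carrier H. vnorm H f \<le> 1}"
    then have f: "f \<in> carrier H" "vnorm H f \<le> 1" by auto
    note [measurable] = g
    have [measurable]: "f \<in> borel_measurable M" using f by (simp add: H_mem_iff)
    have "(\<integral>\<^sup>+x. ennreal \<bar>f x * g x\<bar> \<partial>M)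
        = (\<integral>\<^sup>+\<alpha>. \<integral>\<^sup>+x. ennreal \<bar>f x * g x\<bar> \<partial>R \<alpha> \<partial>count_space I)"
      by (rule nn_integral_partition) measurable
    also have "\<dots> \<le> (\<integral>\<^sup>+\<alpha>. ennreal \<bar>norms f \<alpha> * enn2real (K g \<alpha>)\<bar> \<partial>count_space I)"
    proof (rule nn_integral_mono)
      fix \<alpha> assume "\<alpha> \<in> space (count_space I)"
      then have \<alpha>: "\<alpha> \<in> I" by simp
      interpret X: banach_ideal_space "R \<alpha>" "X \<alpha>" using \<alpha> by (rule component)
      have "(\<integral>\<^sup>+x. ennreal \<bar>f x * g x\<bar> \<partial>R \<alpha>)
          = (\<integral>\<^sup>+x. ennreal \<bar>cut_off A \<alpha> f x * cut_off A \<alpha> g x\<bar> \<partial>R \<alpha>)"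
      proof (rule nn_integral_cong_AE)
        show "AE x in R \<alpha>. ennreal \<bar>f x * g x\<bar> = ennreal \<bar>cut_off A \<alpha> f x * cut_off A \<alpha> g x\<bar>"
          using AE_cut_off[OF \<alpha>, of f] AE_cut_off[OF \<alpha>, of g] by eventually_elim simp
      qed
      also have "\<dots> \<le> ennreal (norms f \<alpha>) * K g \<alpha>"
        using f \<alpha> by (intro X.koethe_hoelder cut_off_measurable_R restrict_measurable g)
          (auto simp: H_mem_iff)
      also have "\<dots> = ennreal (norms f \<alpha>) * ennreal (enn2real (K g \<alpha>))" by (simp only: K[OF \<alpha>])
      also have "\<dots> = ennreal \<bar>norms f \<alpha> * enn2real (K g \<alpha>)\<bar>"
        using norms_nonneg[OF f(1) \<alpha>] by (simp add: ennreal_mult)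
      finally show "(\<integral>\<^sup>+x. ennreal \<bar>f x * g x\<bar> \<partial>R \<alpha>) \<le> ennreal \<bar>norms f \<alpha> * enn2real (K g \<alpha>)\<bar>" .
    qed
    also have "\<dots> \<le> koethe_dual_norm (count_space I) E (\<lambda>\<alpha>. enn2real (K g \<alpha>))"
      using f by (intro koethe_dual_norm_upper) (auto simp: H_mem_iff H_ops)
    finally show "(\<integral>\<^sup>+x. ennreal \<bar>f x * g x\<bar> \<partial>M)
      \<le> koethe_dual_norm (count_space I) E (\<lambda>\<alpha>. enn2real (K g \<alpha>))" .
  qed
qed

lemma koethe_dual_of_koethe_herz:
  "coincide_with_equal_norms (koethe_dual M H)
    (koethe_herz M I A E' (\<lambda>\<alpha>. koethe_dual (R \<alpha>) (X \<alpha>)))" (is "coincide_with_equal_norms ?V ?W")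
proof -
  have V: "g \<in> carrier ?V \<longleftrightarrow> g \<in> borel_measurable M \<and> koethe_dual_norm M H g < \<infinity>" for g
    by (simp add: koethe_dual_def L0_lattice_def)
  have c: "cut_off A \<alpha> g \<in> carrier (koethe_dual (R \<alpha>) (X \<alpha>)) \<longleftrightarrow> K g \<alpha> < \<infinity>"
    if "g \<in> borel_measurable M" "\<alpha> \<in> I" for g \<alpha>
    using cut_off_measurable_R[OF that(2,2) restrict_measurable[OF that(1)]]
    by (simp add: koethe_dual_def L0_lattice_def)
  have k: "(\<lambda>\<alpha>. vnorm (koethe_dual (R \<alpha>) (X \<alpha>)) (cut_off A \<alpha> g)) = (\<lambda>\<alpha>. enn2real (K g \<alpha>))" for g
    by (simp add: koethe_dual_def L0_lattice_def)
  have "g \<in> carrier ?W \<longleftrightarrow> g \<in> borel_measurable M \<and>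
      (\<forall>\<alpha>\<in>I. cut_off A \<alpha> g \<in> carrier (koethe_dual (R \<alpha>) (X \<alpha>))) \<and>
      (\<lambda>\<alpha>. vnorm (koethe_dual (R \<alpha>) (X \<alpha>)) (cut_off A \<alpha> g)) \<in> carrier E'" for g
    by (simp add: koethe_herz_def L0_lattice_def)
  then have W: "g \<in> carrier ?W \<longleftrightarrow> g \<in> borel_measurable M \<and> (\<forall>\<alpha>\<in>I. K g \<alpha> < \<infinity>) \<and>
      koethe_dual_norm (count_space I) E (\<lambda>\<alpha>. enn2real (K g \<alpha>)) < \<infinity>" for g
    unfolding k koethe_E_mem_iff using c by blast
  have W_norm: "vnorm ?W g = enn2real (koethe_dual_norm (count_space I) E (\<lambda>\<alpha>. enn2real (K g \<alpha>)))" for g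
    by (simp add: koethe_herz_def koethe_dual_def L0_lattice_def)
  have V_norm: "vnorm ?V g = enn2real (koethe_dual_norm M H g)" for g
    by (simp add: koethe_dual_def L0_lattice_def)
  have VW: "g \<in> carrier ?V \<longleftrightarrow> g \<in> carrier ?W" for g
    unfolding V W using component_koethe_norm_finite[of g] koethe_norm_eq[of g] by auto
  have "vnorm ?V g = vnorm ?W g" if "g \<in> carrier ?V" for g
    using that koethe_norm_eq[of g] unfolding VW W V_norm W_norm by simp
  with VW show ?thesis unfolding coincide_with_equal_norms_def by blast
qed

end

theorem corollary3p15:
  fixes M :: "'a measure"
    and I :: "'i set"
    and A :: "'i \<Rightarrow> 'a set"
    and X :: "'i \<Rightarrow> ('a \<Rightarrow> real) normed_lattice"
    and E :: "('i \<Rightarrow> real) normed_lattice"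
  assumes "complete_measure M"
    and "sigma_finite_measure M"
    and "countable I"
    and "measurable_partition M I A"
    and "\<And>\<alpha>. \<alpha> \<in> I \<Longrightarrow> banach_ideal_space (restrict_space M (A \<alpha>)) (X \<alpha>)"
    and "\<And>\<alpha>. \<alpha> \<in> I \<Longrightarrow> nontrivial_space (restrict_space M (A \<alpha>)) (X \<alpha>)"
    and "banach_ideal_space (count_space I) E"
    and "order_continuous E"
    and "order_continuous (topological_dual E)"
  shows "(\<forall>g\<in>carrier (direct_sum I (koethe_dual (count_space I) E) (\<lambda>\<alpha>. topological_dual (X \<alpha>))).
           \<forall>f\<in>carrier (koethe_herz M I A E X). (\<lambda>\<alpha>. g \<alpha> (cut_off A \<alpha> f)) summable_on I) \<and>
         isometric_isomorphism (pairing I A (carrier (koethe_herz M I A E X)))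
           (direct_sum I (koethe_dual (count_space I) E) (\<lambda>\<alpha>. topological_dual (X \<alpha>)))
           (topological_dual (koethe_herz M I A E X)) \<and>
         ((\<forall>\<alpha>\<in>I. order_continuous (X \<alpha>)) \<longrightarrow>
           coincide_with_equal_norms
             (koethe_dual M (koethe_herz M I A E X))
             (koethe_herz M I A (koethe_dual (count_space I) E)
               (\<lambda>\<alpha>. koethe_dual (restrict_space M (A \<alpha>)) (X \<alpha>))))"
proof -
  interpret koethe_herz_family I E M A X
    by (intro koethe_herz_family.intro koethe_herz_family_axioms.intro
        banach_sequence_space.intro banach_sequence_space_axioms.intro assms)
  show ?thesis
    using pairing_summable pairing_isometric_isomorphism[OF \<open>order_continuous E\<close>]
      koethe_dual_of_koethe_herz by blast
qed

end
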